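(* Let $G$ be the group of homeomorphisms of $\mathbb{R}$ constructed as described in the context (for any choice of the elements $t_{i+1}$). Then $G$ is dissipated, but does not have conjugates in commuting $\mathbb{Z}$-conjugate.
   Context: Notation: ${}^t g = t g t^{-1}$; $\mathrm{supp}(g) = \{x : g(x) \neq x\}$; the support of a group is the union of the supports of its elements; $\mathrm{Homeo}_c(\mathbb{R})$ is the group of compactly supported homeomorphisms of $\mathbb{R}$. *Construction.* Let $I_1 = (0,1)$ and let $\Gamma_1 = G_1$ be the copy of Thompson's group $F$ (which is finitely generated) acting in the standard way, hence minimally (all orbits dense), on $I_1$ and fixing the complement of $I_1$ pointwise. Inductively, suppose given a group $G_i \leq \mathrm{Homeo}_c(\mathbb{R})$ supported on an interval $I_i$ and a finitely generated subgroup $\Gamma_i \leq G_i$. Choose $t_{i+1} \in \mathrm{Homeo}_c(\mathbb{R})$ with connected support such that $t_{i+1}(I_i) \cap I_i = \emptyset$. Put $I_i^p = t_{i+1}^p(I_i)$ for $p \in \mathbb{Z}$; these intervals are pairwise disjoint. Let $G_i^\omega$ be the group of all homeomorphisms $g$ supported on $\bigsqcup_{p \in \mathbb{Z}} I_i^p$ such that for each $p$ the restriction of $g$ to $I_i^p$ coincides with the restriction of some element of ${}^{t_{i+1}^p} G_i$ (so $G_i^\omega \cong \prod_{\mathbb{Z}} G_i$). Set $G_{i+1} = \langle G_i^\omega, t_{i+1} \rangle$ (isomorphic to the unrestricted wreath product of $G_i$ by $\mathbb{Z}$), $\Gamma_{i+1} = \langle \Gamma_i, t_{i+1} \rangle$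 (isomorphic to the restricted wreath product $\Gamma_i \wr \mathbb{Z}$), and $I_{i+1} = \mathrm{supp}(t_{i+1}) = \mathrm{supp}(\Gamma_{i+1}) = \mathrm{supp}(G_{i+1})$. Let $\Gamma = \bigcup_i \Gamma_i$ and $G = \bigcup_i G_i$. *Dissipated.* Let $X$ be a set written as a directed union of a direct system of subsets $(X_i)_{i \in I}$ and let $\Delta$ be a group of bijections of $X$ that is boundedly supported, i.e. every $g \in \Delta$ satisfies $\mathrm{supp}(g) \subset X_i$ for some $i$. A *dissipator* for $\Delta$ and $X_i$ is an element $t_i \in \Delta$ such that (1) $t_i^p(X_i) \cap X_i = \emptyset$ for all $p \geq 1$; (2) for every $g \in \Delta$ supported on $X_i$, the bijection $f(g)$ which equals ${}^{t_i^p} g$ on $t_i^p(X_i)$ for every $p \geq 1$ and equals the identity elsewhere belongs to $\Delta$. The group $\Delta$ is *dissipated* if there is a dissipator for $\Delta$ and $X_i$ for every $i \in I$. An abstract group is called dissipated if it can be realised as such a group of bijections for some set $X$ and some system $(X_i)_{i\in I}$. *Conjugates in commuting $\mathbb{Z}$-conjugate.* A group $\Delta$ has this property if there exist a subgroup $\Lambda \leq \Delta$ and $t \in \Delta$ such that (1) $[\Lambda, {}^{t^p}\Lambda] = 1$ for all integers $p \geq 1$; (2) every finite subset of $\Delta$ is contained in a conjugate of $\Lambda$ in $\Delta$. *)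

theory Defs
  imports "HOL-Analysis.Analysis" "HOL-Algebra.Bij" "HOL-Algebra.Generated_Groups"
begin

section \<open>Groups of bijections\<close>

definition supp_on :: "'x set \<Rightarrow> ('x \<Rightarrow> 'x) \<Rightarrow> 'x set"
  where "supp_on X g = {x \<in> X. g x \<noteq> x}"

definition conjugate :: "('a, 'b) monoid_scheme \<Rightarrow> 'a \<Rightarrow> 'a \<Rightarrow> 'a"
  where "conjugate G t g = t \<otimes>\<^bsub>G\<^esub> g \<otimes>\<^bsub>G\<^esub> inv\<^bsub>G\<^esub> t"


section \<open>Dissipated groups\<close>

text \<open>The second condition says that the bijection which is \<open>t\<^sup>p g t\<^sup>-\<^sup>p\<close> on \<open>t\<^sup>p(Y)\<close> for every
  \<open>p \<ge> 1\<close> and the identity elsewhere, here called \<open>f\<close>, lies in \<open>\<Delta>\<close>; the two clauses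
  determine \<open>f\<close> on all of \<open>X\<close>, and elements of \<^term>\<open>Bij X\<close> are determined by their values on \<open>X\<close>.\<close>

definition dissipator :: "'x set \<Rightarrow> ('x \<Rightarrow> 'x) set \<Rightarrow> 'x set \<Rightarrow> ('x \<Rightarrow> 'x) \<Rightarrow> bool"
  where "dissipator X \<Delta> Y t \<longleftrightarrow>
    t \<in> \<Delta> \<and>
    (\<forall>p::nat. p \<ge> 1 \<longrightarrow> (t [^]\<^bsub>BijGroup X\<^esub> p) ` Y \<inter> Y = {}) \<and>
    (\<forall>g\<in>\<Delta>. supp_on X g \<subseteq> Y \<longrightarrow>
      (\<exists>f\<in>\<Delta>.
        (\<forall>p::nat. p \<ge> 1 \<longrightarrow>
          (\<forall>x \<in> (t [^]\<^bsub>BijGroup X\<^esub> p) ` Y.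
             f x = conjugate (BijGroup X) (t [^]\<^bsub>BijGroup X\<^esub> p) g x)) \<and>
        (\<forall>x \<in> X - (\<Union>p\<in>{1::nat..}. (t [^]\<^bsub>BijGroup X\<^esub> p) ` Y). f x = x)))"

text \<open>The index set of a direct system of subsets carries the preorder given by inclusion.\<close>

definition directed_union :: "'x set \<Rightarrow> 'i set \<Rightarrow> ('i \<Rightarrow> 'x set) \<Rightarrow> bool"
  where "directed_union X I Xs \<longleftrightarrow>
    I \<noteq> {} \<and> (\<forall>i\<in>I. \<forall>j\<in>I. \<exists>k\<in>I. Xs i \<subseteq> Xs k \<and> Xs j \<subseteq> Xs k) \<and> X = (\<Union>i\<in>I. Xs i)"

definition dissipated_on :: "'x set \<Rightarrow> 'i set \<Rightarrow> ('i \<Rightarrow> 'x set) \<Rightarrow> ('x \<Rightarrow> 'x) set \<Rightarrow> bool"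
  where "dissipated_on X I Xs \<Delta> \<longleftrightarrow>
    directed_union X I Xs \<and>
    subgroup \<Delta> (BijGroup X) \<and>
    (\<forall>g\<in>\<Delta>. \<exists>i\<in>I. supp_on X g \<subseteq> Xs i) \<and>
    (\<forall>i\<in>I. \<exists>t. dissipator X \<Delta> (Xs i) t)"

text \<open>HOL cannot quantify over types, so the types in which the set \<open>X\<close> and the index set live
  are explicit arguments.\<close>

definition dissipated :: "'x itself \<Rightarrow> 'i itself \<Rightarrow> ('a, 'b) monoid_scheme \<Rightarrow> bool"
  where "dissipated TX TI G \<longleftrightarrow>
    (\<exists>(X :: 'x set) (I :: 'i set) Xs \<Delta>.
       dissipated_on X I Xs \<Delta> \<and> G \<cong> (BijGroup X)\<lparr>carrier := \<Delta>\<rparr>)"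


section \<open>Conjugates in commuting conjugates\<close>

definition commuting_Z_conjugates :: "('a, 'b) monoid_scheme \<Rightarrow> bool"
  where "commuting_Z_conjugates G \<longleftrightarrow>
    (\<exists>\<Lambda> t. subgroup \<Lambda> G \<and> t \<in> carrier G \<and>
      (\<forall>p::nat. p \<ge> 1 \<longrightarrow>
        (\<forall>a\<in>\<Lambda>. \<forall>b \<in> conjugate G (t [^]\<^bsub>G\<^esub> p) ` \<Lambda>.
           a \<otimes>\<^bsub>G\<^esub> b \<otimes>\<^bsub>G\<^esub> inv\<^bsub>G\<^esub> a \<otimes>\<^bsub>G\<^esub> inv\<^bsub>G\<^esub> b = \<one>\<^bsub>G\<^esub>)) \<and>
      (\<forall>S. finite S \<and> S \<subseteq> carrier G \<longrightarrow>
        (\<exists>g\<in>carrier G. S \<subseteq> conjugate G g ` \<Lambda>)))"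


section \<open>Homeomorphisms of the line\<close>

abbreviation SymR :: "(real \<Rightarrow> real) monoid"
  where "SymR \<equiv> BijGroup UNIV"

abbreviation supp :: "(real \<Rightarrow> real) \<Rightarrow> real set"
  where "supp \<equiv> supp_on UNIV"

definition Homeo :: "(real \<Rightarrow> real) set"
  where "Homeo = {f. \<exists>g. homeomorphism UNIV UNIV f g}"

definition Homeo_c :: "(real \<Rightarrow> real) set"
  where "Homeo_c = {f \<in> Homeo. compact (closure (supp f))}"

text \<open>Thompson's group \<open>F\<close>: piecewise affine homeomorphisms of the unit interval with finitely
  many breakpoints, all of them dyadic rationals, and with slopes that are powers of \<open>2\<close>,
  extended by the identity to the line.  The library's \<^term>\<open>dyadics\<close> are the nonnegative
  dyadic rationals.\<close>

definition Thompson_F :: "(real \<Rightarrow> real) set"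
  where "Thompson_F =
    {f \<in> Homeo. supp f \<subseteq> {0<..<1} \<and>
      (\<exists>B. finite B \<and> B \<subseteq> dyadics \<inter> {0..1} \<and>
        (\<forall>a b. 0 \<le> a \<and> a < b \<and> b \<le> 1 \<and> {a<..<b} \<inter> B = {} \<longrightarrow>
          (\<exists>(k::int) c. \<forall>x\<in>{a<..<b}. f x = 2 powi k * x + c)))}"


section \<open>The tower of groups\<close>

definition translate :: "(real \<Rightarrow> real) \<Rightarrow> real set \<Rightarrow> int \<Rightarrow> real set"
  where "translate t J p = (t [^]\<^bsub>SymR\<^esub> p) ` J"

definition omega_group :: "(real \<Rightarrow> real) \<Rightarrow> real set \<Rightarrow> (real \<Rightarrow> real) set \<Rightarrow> (real \<Rightarrow> real) set"
  where "omega_group t J H =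
    {g \<in> Homeo. supp g \<subseteq> (\<Union>p. translate t J p) \<and>
      (\<forall>p. \<exists>h \<in> conjugate SymR (t [^]\<^bsub>SymR\<^esub> p) ` H. \<forall>x \<in> translate t J p. g x = h x)}"

text \<open>The tower is indexed from \<open>0\<close> instead of \<open>1\<close>; the value \<open>t 0\<close> is never used.\<close>

primrec tower_interval :: "(nat \<Rightarrow> real \<Rightarrow> real) \<Rightarrow> nat \<Rightarrow> real set"
  where
    "tower_interval t 0 = {0<..<1}"
  | "tower_interval t (Suc i) = supp (t (Suc i))"

primrec tower_group :: "(nat \<Rightarrow> real \<Rightarrow> real) \<Rightarrow> nat \<Rightarrow> (real \<Rightarrow> real) set"
  where
    "tower_group t 0 = Thompson_F"
  | "tower_group t (Suc i) =
      generate SymR (omega_group (t (Suc i)) (tower_interval t i) (tower_group t i) \<union> {t (Suc i)})"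

definition admissible_choice :: "(nat \<Rightarrow> real \<Rightarrow> real) \<Rightarrow> bool"
  where "admissible_choice t \<longleftrightarrow>
    (\<forall>i. t (Suc i) \<in> Homeo_c \<and> connected (supp (t (Suc i))) \<and>
         t (Suc i) ` tower_interval t i \<inter> tower_interval t i = {})"

definition limit_group :: "(nat \<Rightarrow> real \<Rightarrow> real) \<Rightarrow> (real \<Rightarrow> real) monoid"
  where "limit_group t = SymR\<lparr>carrier := (\<Union>i. tower_group t i)\<rparr>"

end

(*
  Dissipated: an element of G supported on I_i already lies in G_i, because an element of a
  later stage either moves an earlier interval off itself or acts on it like an element of the
  earlier stage; hence t_{i+1} dissipates I_i.

  No commuting Z-conjugates: let t in G_i, let a, b be non-commuting elements of F and let
  T = t_{i+1}.  If a, b, T all lie in a conjugate of Lambda, then some conjugate r of t satisfies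
  [u, r v r^-1] = 1 for all u, v in {a, b, T}.  Either r is a conjugate of t by an element moving
  I_i off itself, so that r is the identity on I_i, or r is supported on I_i, and then
  [T, r T r^-1] = 1 evaluated on I_i gives r = 1.  In both cases r commutes with b, so
  [a, b] = 1, a contradiction.
*)
theory Submission
  imports Defs
begin

text \<open>Every map involved has bounded support, hence is increasing, and an increasing bijection
  of the line is a homeomorphism; so continuity of a constructed map need not be examined point by
  point.

  The dichotomy for intervals comes from writing an element of stage i+1 as f t^n, with t = t_{i+1}
  and f in the product of conjugates of G_i: f keeps every translate of I_i, so n alone decides
  whether I_i is moved off itself. Dissipation uses that this product is unrestricted: infinitely
  many conjugates of g, placed on the translates with p >= 1, still form one element of the group.

  In the negative part a and b alone would not do. Counting stages from 0, for i >= 1 the element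
  t_i is supported on I_i and moves I_0 off itself, so r = t_i makes r F r^-1 commute with F. Adding
  T, which moves all of I_i off itself, excludes such r.\<close>

section \<open>Bijections and homeomorphisms of the line\<close>

text \<open>HOL-Algebra's syntax for group inverses hides the notation \<open>inv\<close> for inverse functions.\<close>

abbreviation finv :: "(real \<Rightarrow> real) \<Rightarrow> real \<Rightarrow> real"
  where "finv f \<equiv> inv_into UNIV f"

interpretation SymR: group SymR
  by (rule group_BijGroup)

lemma carrier_SymR: "carrier SymR = {f. bij f}"
  by (auto simp: BijGroup_def Bij_def)

lemma mult_SymR: "bij f \<Longrightarrow> bij g \<Longrightarrow> f \<otimes>\<^bsub>SymR\<^esub> g = f \<circ> g"
  by (simp add: BijGroup_def Bij_def compose_def fun_eq_iff)

lemma one_SymR [simp]: "\<one>\<^bsub>SymR\<^esub> = id"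
  by (simp add: BijGroup_def fun_eq_iff)

lemma inv_SymR: "bij f \<Longrightarrow> inv\<^bsub>SymR\<^esub> f = finv f"
  by (simp add: inv_BijGroup Bij_def fun_eq_iff)

lemma conjugate_SymR: "bij t \<Longrightarrow> bij g \<Longrightarrow> conjugate SymR t g = t \<circ> g \<circ> finv t"
  by (simp add: conjugate_def mult_SymR inv_SymR bij_comp bij_imp_bij_inv)

lemma subgroup_SymR_iff:
  "subgroup H SymR \<longleftrightarrow>
    (\<forall>h\<in>H. bij h) \<and> id \<in> H \<and> (\<forall>g\<in>H. \<forall>h\<in>H. g \<circ> h \<in> H) \<and> (\<forall>h\<in>H. finv h \<in> H)"
proof
  assume H: "subgroup H SymR"
  then have bij: "bij h" if "h \<in> H" for h
    using that subgroup.subset[OF H] carrier_SymR by auto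
  show "(\<forall>h\<in>H. bij h) \<and> id \<in> H \<and> (\<forall>g\<in>H. \<forall>h\<in>H. g \<circ> h \<in> H) \<and> (\<forall>h\<in>H. finv h \<in> H)"
    using bij subgroup.one_closed[OF H] subgroup.m_closed[OF H] subgroup.m_inv_closed[OF H]
    by (simp add: mult_SymR one_SymR inv_SymR)
next
  assume "(\<forall>h\<in>H. bij h) \<and> id \<in> H \<and> (\<forall>g\<in>H. \<forall>h\<in>H. g \<circ> h \<in> H) \<and> (\<forall>h\<in>H. finv h \<in> H)"
  then show "subgroup H SymR"
    by unfold_locales (auto simp: carrier_SymR mult_SymR one_SymR inv_SymR)
qed

lemma supp_outside: "supp f \<subseteq> A \<Longrightarrow> x \<notin> A \<Longrightarrow> f x = x"
  by (auto simp: supp_on_def)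

lemma bij_maps_into:
  assumes "bij f" "supp f \<subseteq> A" "x \<in> A"
  shows "f x \<in> A"
proof (rule ccontr)
  assume "f x \<notin> A"
  then have "f (f x) = f x"
    by (rule supp_outside[OF assms(2)])
  then have "f x = x"
    using assms(1) by (simp add: bij_is_inj inj_eq)
  with \<open>f x \<notin> A\<close> \<open>x \<in> A\<close> show False
    by simp
qed

lemma supp_inv:
  assumes "bij f"
  shows "supp (finv f) = supp f"
proof -
  have "finv f x = x \<longleftrightarrow> f x = x" for x
    using bij_inv_eq_iff[OF assms, of x x] by auto
  then show ?thesis
    by (simp add: supp_on_def)
qed

lemma supp_comp_subset: "supp f \<subseteq> A \<Longrightarrow> supp g \<subseteq> A \<Longrightarrow> supp (f \<circ> g) \<subseteq> A"
proof
  fix x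
  assume A: "supp f \<subseteq> A" "supp g \<subseteq> A" and "x \<in> supp (f \<circ> g)"
  then have "f (g x) \<noteq> x"
    by (simp add: supp_on_def)
  then show "x \<in> A"
    using supp_outside[OF A(1), of x] supp_outside[OF A(2), of x] by metis
qed

lemma bij_image_supp:
  assumes "bij f" "supp f \<subseteq> A"
  shows "f ` A = A"
proof
  show "f ` A \<subseteq> A"
    using bij_maps_into[OF assms] by blast
  show "A \<subseteq> f ` A"
  proof
    fix x
    assume "x \<in> A"
    then have "finv f x \<in> A"
      using assms bij_maps_into[of "finv f" A x] by (simp add: bij_imp_bij_inv supp_inv)
    moreover have "x = f (finv f x)"
      using assms(1) by (simp add: bij_is_surj surj_f_inv_f)
    ultimately show "x \<in> f ` A"
      by blast
  qed
qed

section \<open>Homeomorphisms and increasing bijections\<close>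

lemma HomeoD:
  assumes "f \<in> Homeo"
  shows "bij f" "continuous_on UNIV f"
proof -
  obtain g where g: "homeomorphism UNIV UNIV f g"
    using assms by (auto simp: Homeo_def)
  then show "bij f"
    unfolding homeomorphism_def by (intro o_bij[of g]) auto
  show "continuous_on UNIV f"
    using g by (simp add: homeomorphism_def)
qed

text \<open>This class replaces homeomorphisms throughout: it is closed under composition and
  inverse, and membership is a matter of order only.\<close>

definition IncBij :: "(real \<Rightarrow> real) set"
  where "IncBij = {f. strict_mono f \<and> surj f}"

lemma IncBijD:
  assumes "f \<in> IncBij"
  shows "bij f" "f x < f y \<longleftrightarrow> x < y" "f x \<le> f y \<longleftrightarrow> x \<le> y" "f x = f y \<longleftrightarrow> x = y"
    "finv f (f x) = x" "f (finv f x) = x"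
proof -
  have s: "strict_mono f" "surj f"
    using assms by (auto simp: IncBij_def)
  then show "bij f"
    by (simp add: bij_def strict_mono_imp_inj_on)
  then show "f x < f y \<longleftrightarrow> x < y" "f x \<le> f y \<longleftrightarrow> x \<le> y" "f x = f y \<longleftrightarrow> x = y"
    "finv f (f x) = x" "f (finv f x) = x"
    using s by (simp_all add: strict_mono_less strict_mono_less_eq strict_mono_eq
        bij_is_inj surj_f_inv_f)
qed

lemma IncBij_id [simp]: "id \<in> IncBij"
  by (simp add: IncBij_def strict_mono_def)

lemma IncBij_comp [intro]: "f \<in> IncBij \<Longrightarrow> g \<in> IncBij \<Longrightarrow> f \<circ> g \<in> IncBij"
  unfolding IncBij_def using comp_surj[of g f] by (auto simp: strict_mono_def o_def)

lemma IncBij_inv [intro]: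
  assumes "f \<in> IncBij"
  shows "finv f \<in> IncBij"
proof -
  have "finv f x < finv f y" if "x < y" for x y
    using that IncBijD(2)[OF assms, of "finv f x" "finv f y"] IncBijD(6)[OF assms] by simp
  moreover have "surj (finv f)"
    using IncBijD(1)[OF assms] by (intro bij_is_surj bij_imp_bij_inv)
  ultimately show ?thesis
    by (simp add: IncBij_def strict_mono_def)
qed

text \<open>A monotone map can only be discontinuous by jumping, and a surjection skips no
  value.\<close>

lemma IncBij_continuous:
  assumes "f \<in> IncBij"
  shows "continuous_on A f"
proof -
  have "continuous_on UNIV f"
    using assms by (intro continuous_onI_mono) (auto simp: IncBij_def strict_mono_less_eq)
  then show ?thesis
    by (rule continuous_on_subset) simp
qed

lemma IncBij_imp_Homeo:
  assumes "f \<in> IncBij"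
  shows "f \<in> Homeo"
proof -
  have "homeomorphism UNIV UNIV f (finv f)"
    unfolding homeomorphism_def
    using IncBijD[OF assms] IncBijD[OF IncBij_inv[OF assms]] IncBij_continuous[OF assms]
      IncBij_continuous[OF IncBij_inv[OF assms]]
    by (simp add: bij_is_surj)
  then show ?thesis
    by (auto simp: Homeo_def)
qed

text \<open>On an interval a continuous injection is strictly monotone, and two fixed points outside
  the support rule out that it decreases.\<close>

lemma Homeo_bounded_supp_IncBij:
  assumes f: "f \<in> Homeo" and supp: "bounded (supp f)"
  shows "f \<in> IncBij"
proof -
  have inj: "inj_on f A" and cont: "continuous_on A f" for A
    using HomeoD[OF f] by (auto simp: bij_def intro: inj_on_subset continuous_on_subset)
  obtain C where C: "\<bar>x\<bar> \<le> C" if "x \<in> supp f" for x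
    using supp by (auto simp: bounded_iff)
  have "f x < f y" if "x < y" for x y
  proof -
    \<comment> \<open>\<open>a\<close> and \<open>b\<close> lie beyond \<open>x\<close>,
      \<open>y\<close> and the support, so both are fixed. The absolute value covers a negative
      \<open>C\<close>, possible when the support is empty.\<close>
    define a where "a = min x (- \<bar>C\<bar>) - 1"
    define b where "b = max y \<bar>C\<bar> + 1"
    have ab: "a < x" "y < b" "C < \<bar>a\<bar>" "C < \<bar>b\<bar>"
      unfolding a_def b_def by linarith+
    then have "f a = a" "f b = b"
      using C[of a] C[of b] by (auto simp: supp_on_def)
    note ab = ab this
    have "(f a < f x \<and> f x < f b) \<or> (f b < f x \<and> f x < f a)"
      using ab \<open>x < y\<close> by (intro continuous_inj_imp_mono inj cont) auto
    moreover have "(f x < f y \<and> f y < f b) \<or> (f b < f y \<and> f y < f x)"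
      using ab \<open>x < y\<close> by (intro continuous_inj_imp_mono inj cont) auto
    ultimately show ?thesis
      using ab \<open>x < y\<close> by linarith
  qed
  then show ?thesis
    using HomeoD(1)[OF f] by (simp add: IncBij_def strict_mono_def bij_def)
qed

lemma Homeo_c_IncBij: "f \<in> Homeo_c \<Longrightarrow> f \<in> IncBij" "f \<in> Homeo_c \<Longrightarrow> bounded (supp f)"
proof -
  assume f: "f \<in> Homeo_c"
  then show "bounded (supp f)"
    by (auto simp: Homeo_c_def intro: bounded_subset[OF compact_imp_bounded closure_subset])
  then show "f \<in> IncBij"
    using f by (auto simp: Homeo_c_def intro: Homeo_bounded_supp_IncBij)
qed

section \<open>Thompson's group\<close>

lemma dyadics_add: "x \<in> dyadics \<Longrightarrow> y \<in> dyadics \<Longrightarrow> x + y \<in> (dyadics :: real set)"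
proof -
  assume "x \<in> dyadics" "y \<in> dyadics"
  then obtain m k m' k' where "x = of_nat m / 2^k" "y = of_nat m' / 2^k'"
    by (auto simp: dyadics_def)
  then have "x + y = of_nat (m * 2^k' + m' * 2^k) / 2^(k + k')"
    by (simp add: add_divide_distrib power_add)
  then show ?thesis
    unfolding dyadics_def by blast
qed

lemma dyadics_diff: "x \<in> dyadics \<Longrightarrow> y \<in> dyadics \<Longrightarrow> y \<le> x \<Longrightarrow> x - y \<in> (dyadics :: real set)"
proof -
  assume "x \<in> dyadics" "y \<in> dyadics" "y \<le> x"
  then obtain m k m' k' where *: "x = of_nat m / 2^k" "y = of_nat m' / 2^k'"
    by (auto simp: dyadics_def)
  have "real (m' * 2^k) \<le> real (m * 2^k')"
    using \<open>y \<le> x\<close> unfolding * by (simp add: field_simps)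
  then have "m' * 2^k \<le> m * 2^k'"
    by (simp only: of_nat_le_iff)
  then have "x - y = of_nat (m * 2^k' - m' * 2^k) / 2^(k + k')"
    using * by (simp add: of_nat_diff diff_divide_distrib power_add)
  then show ?thesis
    unfolding dyadics_def by blast
qed

lemma dyadics_scale: "x \<in> dyadics \<Longrightarrow> 2 powi n * x \<in> (dyadics :: real set)"
proof -
  assume "x \<in> dyadics"
  then obtain m k where x: "x = of_nat m / 2^k"
    by (auto simp: dyadics_def)
  show ?thesis
  proof (cases n rule: int_cases2)
    case (nonneg j)
    then have "2 powi n * x = of_nat (2^j * m) / 2^k"
      by (simp add: x)
    then show ?thesis
      unfolding dyadics_def by blast
  next
    case (nonpos j)
    then have "2 powi n * x = of_nat m / 2^(k + j)"
      by (simp add: x power_int_minus power_add field_simps)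
    then show ?thesis
      unfolding dyadics_def by blast
  qed
qed

text \<open>The breakpoint clause of \<open>Thompson_F\<close> with \<open>B\<close> as a parameter,
  so that candidate breakpoints of inverses and composites can be named.\<close>

definition dyadic_affine_off :: "real set \<Rightarrow> (real \<Rightarrow> real) \<Rightarrow> bool"
  where "dyadic_affine_off B f \<longleftrightarrow>
    (\<forall>a b. 0 \<le> a \<and> a < b \<and> b \<le> 1 \<and> {a<..<b} \<inter> B = {} \<longrightarrow>
          (\<exists>(k::int) c. \<forall>x\<in>{a<..<b}. f x = 2 powi k * x + c))"

lemma Thompson_F_iff:
  "f \<in> Thompson_F \<longleftrightarrow> f \<in> IncBij \<and> supp f \<subseteq> {0<..<1} \<and>
    (\<exists>B. finite B \<and> B \<subseteq> dyadics \<inter> {0..1} \<and> dyadic_affine_off B f)"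
proof -
  have "f \<in> IncBij" if "f \<in> Homeo" "supp f \<subseteq> {0<..<1}"
    using that(1) bounded_subset[OF _ that(2)] bounded_box[of 0 "1::real"]
    by (intro Homeo_bounded_supp_IncBij) (simp_all add: box_real)
  then show ?thesis
    by (auto simp: Thompson_F_def dyadic_affine_off_def IncBij_imp_Homeo)
qed

lemma Thompson_F_bounds:
  assumes "f \<in> IncBij" "supp f \<subseteq> {0<..<1}"
  shows "f 0 = 0" "f 1 = 1" "0 \<le> f x \<longleftrightarrow> 0 \<le> x" "f x \<le> 1 \<longleftrightarrow> x \<le> 1"
proof -
  show 01: "f 0 = 0" "f 1 = 1"
    using supp_outside[OF assms(2)] by simp_all
  show "0 \<le> f x \<longleftrightarrow> 0 \<le> x" "f x \<le> 1 \<longleftrightarrow> x \<le> 1"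
    using IncBijD(3)[OF assms(1), of 0 x] IncBijD(3)[OF assms(1), of x 1] 01 by auto
qed

text \<open>Induction on the number of breakpoints strictly between \<open>x\<close> and
  \<open>y\<close>. Without any, the increment is a power of 2 times \<open>y - x\<close>; otherwise
  it is split at a breakpoint, which is dyadic itself.\<close>

lemma dyadic_affine_off_increment:
  assumes f: "f \<in> IncBij" and B: "finite B" "B \<subseteq> dyadics" and pl: "dyadic_affine_off B f"
  shows "x \<in> dyadics \<Longrightarrow> y \<in> dyadics \<Longrightarrow> 0 \<le> x \<Longrightarrow> x < y \<Longrightarrow> y \<le> 1 \<Longrightarrow> f y - f x \<in> dyadics"
proof (induction "card (B \<inter> {x<..<y})" arbitrary: x y rule: less_induct)
  case less
  show ?case
  proof (cases "{x<..<y} \<inter> B = {}")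
    case True
    then obtain k c where kc: "\<And>u. u \<in> {x<..<y} \<Longrightarrow> f u = 2 powi k * u + c"
      using pl less.prems unfolding dyadic_affine_off_def by meson
    \<comment> \<open>The affine formula is given on the open interval only; continuity carries it
      to the end points.\<close>
    have cont: "continuous_on (closure {x<..<y}) (\<lambda>u. f u - (2 powi k * u + c))"
      by (intro continuous_intros IncBij_continuous f)
    have "f u - (2 powi k * u + c) = 0" if "u \<in> closure {x<..<y}" for u
      using continuous_constant_on_closure[OF cont _ that, of 0] kc by simp
    then have "f y - f x = 2 powi k * (y - x)"
      using less.prems by (simp add: algebra_simps)
    then show ?thesis
      using less.prems by (simp add: dyadics_scale dyadics_diff)
  next
    case False
    then obtain b where b: "b \<in> B" "x < b" "b < y"
      by auto
    have "card (B \<inter> {x<..<b}) < card (B \<inter> {x<..<y})" "card (B \<inter> {b<..<y}) < card (B \<inter> {x<..<y})"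
      using b B by (auto intro!: psubset_card_mono)
    then have "f b - f x \<in> dyadics" "f y - f b \<in> dyadics"
      using less b B by auto
    then show ?thesis
      using dyadics_add by fastforce
  qed
qed

text \<open>Needed because inverses and composites have images of dyadic breakpoints as their own
  breakpoints. As \<open>f\<close> fixes 0, its value at \<open>x\<close> is an increment.\<close>

lemma Thompson_F_dyadic:
  assumes "f \<in> Thompson_F" "x \<in> dyadics" "0 \<le> x" "x \<le> 1"
  shows "f x \<in> dyadics"
proof (cases "x = 0")
  case True
  then show ?thesis
    using assms Thompson_F_bounds(1) by (metis Thompson_F_iff)
next
  case False
  obtain B where "finite B" "B \<subseteq> dyadics" "dyadic_affine_off B f"
    using assms(1) by (auto simp: Thompson_F_iff)
  then have "f x - f 0 \<in> dyadics"
    using assms False real_in_dyadics[of 0]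
    by (intro dyadic_affine_off_increment) (auto simp: Thompson_F_iff)
  then show ?thesis
    using assms(1) Thompson_F_bounds(1)[of f] by (simp add: Thompson_F_iff)
qed

text \<open>Between the images under \<open>f\<close> of its breakpoints the inverse is affine, with
  the reciprocal slope.\<close>

lemma Thompson_F_inv:
  assumes "f \<in> Thompson_F"
  shows "finv f \<in> Thompson_F"
proof -
  obtain B where B: "finite B" "B \<subseteq> dyadics \<inter> {0..1}" "dyadic_affine_off B f"
    and f: "f \<in> IncBij" "supp f \<subseteq> {0<..<1}"
    using assms by (auto simp: Thompson_F_iff)
  note F = IncBijD[OF f(1)] Thompson_F_bounds[OF f]
  have g: "finv f \<in> IncBij" "supp (finv f) \<subseteq> {0<..<1}"
    using f F(1) by (auto simp: supp_inv)
  note G = IncBijD[OF g(1)] Thompson_F_bounds[OF g]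
  have "dyadic_affine_off (f ` B) (finv f)"
    unfolding dyadic_affine_off_def
  proof (intro allI impI, elim conjE)
    fix a b :: real
    assume ab: "0 \<le> a" "a < b" "b \<le> 1" "{a<..<b} \<inter> f ` B = {}"
    have "{finv f a<..<finv f b} \<inter> B = {}"
    proof safe
      fix y
      assume "y \<in> {finv f a<..<finv f b}" "y \<in> B"
      then have "f y \<in> {a<..<b} \<inter> f ` B"
        using F(2)[of "finv f a" y] F(2)[of y "finv f b"] F(6) by auto
      with ab show "y \<in> {}"
        by blast
    qed
    then obtain k c where kc: "\<And>x. x \<in> {finv f a<..<finv f b} \<Longrightarrow> f x = 2 powi k * x + c"
      using B(3)[unfolded dyadic_affine_off_def, rule_format, of "finv f a" "finv f b"] ab G
      by auto
    have "finv f x = 2 powi (- k) * x + - (2 powi (- k) * c)" if "x \<in> {a<..<b}" for x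
    proof -
      have "x = 2 powi k * finv f x + c"
        using kc[of "finv f x"] that G F by simp
      then show ?thesis
        by (simp add: power_int_minus field_simps)
    qed
    then show "\<exists>k c. \<forall>x\<in>{a<..<b}. finv f x = 2 powi k * x + c"
      by blast
  qed
  moreover have "f ` B \<subseteq> dyadics \<inter> {0..1}"
    using B(2) Thompson_F_dyadic[OF assms] by (auto simp: F subset_iff)
  ultimately show ?thesis
    using g B by (auto simp: Thompson_F_iff)
qed

text \<open>The composite can only break where \<open>g\<close> breaks or where \<open>g\<close>
  takes a breakpoint of \<open>f\<close> as its value; elsewhere slopes multiply.\<close>

lemma Thompson_F_comp:
  assumes "f \<in> Thompson_F" "g \<in> Thompson_F"
  shows "f \<circ> g \<in> Thompson_F"
proof -
  obtain B where B: "finite B" "B \<subseteq> dyadics \<inter> {0..1}" "dyadic_affine_off B f"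
    and f: "f \<in> IncBij" "supp f \<subseteq> {0<..<1}"
    using assms by (auto simp: Thompson_F_iff)
  obtain C where C: "finite C" "C \<subseteq> dyadics \<inter> {0..1}" "dyadic_affine_off C g"
    and g: "g \<in> IncBij" "supp g \<subseteq> {0<..<1}"
    using assms by (auto simp: Thompson_F_iff)
  note G = IncBijD[OF g(1)] Thompson_F_bounds[OF g]
  have "finv g \<in> Thompson_F"
    using assms(2) by (rule Thompson_F_inv)
  then have G': "0 \<le> finv g x \<longleftrightarrow> 0 \<le> x" "finv g x \<le> 1 \<longleftrightarrow> x \<le> 1" for x
    using Thompson_F_bounds by (auto simp: Thompson_F_iff)
  have "dyadic_affine_off (C \<union> finv g ` B) (f \<circ> g)"
    unfolding dyadic_affine_off_def
  proof (intro allI impI, elim conjE)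
    fix a b :: real
    assume ab: "0 \<le> a" "a < b" "b \<le> 1" "{a<..<b} \<inter> (C \<union> finv g ` B) = {}"
    then obtain k c where kc: "\<And>x. x \<in> {a<..<b} \<Longrightarrow> g x = 2 powi k * x + c"
      using C(3) unfolding dyadic_affine_off_def by (metis Int_Un_distrib Un_empty)
    have "{g a<..<g b} \<inter> B = {}"
    proof safe
      fix y
      assume "y \<in> {g a<..<g b}" "y \<in> B"
      then have "finv g y \<in> {a<..<b} \<inter> finv g ` B"
        using G(2)[of a "finv g y"] G(2)[of "finv g y" b] G(6) by auto
      with ab show "y \<in> {}"
        by blast
    qed
    then obtain l d where ld: "\<And>x. x \<in> {g a<..<g b} \<Longrightarrow> f x = 2 powi l * x + d"
      using B(3)[unfolded dyadic_affine_off_def, rule_format, of "g a" "g b"] ab G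
      by auto
    have "(f \<circ> g) x = 2 powi (l + k) * x + (2 powi l * c + d)" if "x \<in> {a<..<b}" for x
      using kc[OF that] ld[of "g x"] that G(2)[of a x] G(2)[of x b]
      by (simp add: power_int_add algebra_simps)
    then show "\<exists>k c. \<forall>x\<in>{a<..<b}. (f \<circ> g) x = 2 powi k * x + c"
      by blast
  qed
  moreover have "C \<union> finv g ` B \<subseteq> dyadics \<inter> {0..1}"
    using B(2) C(2) Thompson_F_dyadic[OF \<open>finv g \<in> Thompson_F\<close>] by (auto simp: G' subset_iff)
  moreover have "f \<circ> g \<in> IncBij" "supp (f \<circ> g) \<subseteq> {0<..<1}"
    using f g supp_comp_subset by auto
  ultimately show ?thesis
    using B C unfolding Thompson_F_iff by (metis finite_UnI finite_imageI)
qed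

lemma subgroup_Thompson_F: "subgroup Thompson_F SymR"
proof -
  have "\<exists>k c. \<forall>x\<in>{a<..<b}. x = 2 powi k * x + c" for a b :: real
    by (rule exI[of _ 0], rule exI[of _ 0]) simp
  then have "dyadic_affine_off {} id"
    by (simp add: dyadic_affine_off_def)
  then have "id \<in> Thompson_F"
    unfolding Thompson_F_iff by (auto simp: supp_on_def)
  then show ?thesis
    using Thompson_F_comp Thompson_F_inv IncBijD(1) by (auto simp: subgroup_SymR_iff Thompson_F_iff)
qed

text \<open>For \<open>h = 1/4\<close> and \<open>h = 1/8\<close> these are the standard generators
  x_0 and x_1 of F; in general it is x_0 rescaled to the interval from \<open>1 - 4 * h\<close> to
  1.\<close>

definition thompson_gen :: "real \<Rightarrow> real \<Rightarrow> real"
  where "thompson_gen h x =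
    (if x \<le> 1 - 4 * h then x else if x \<le> 1 - 2 * h then (x + 1 - 4 * h) / 2
     else if x \<le> 1 - h then x - h else if x \<le> 1 then 2 * x - 1 else x)"

lemma thompson_gen_in_Thompson_F:
  assumes "0 < h" "h \<le> 1 / 4" "h \<in> dyadics"
  shows "thompson_gen h \<in> Thompson_F"
proof -
  let ?f = "thompson_gen h"
  \<comment> \<open>The inverse map, with slopes 2, 1, 1/2 on the images of the three pieces; it
    witnesses surjectivity.\<close>
  let ?g = "\<lambda>x. if x \<le> 1 - 4 * h then x else if x \<le> 1 - 3 * h then 2 * x - 1 + 4 * h
     else if x \<le> 1 - 2 * h then x + h else if x \<le> 1 then (x + 1) / 2 else x"
  have "?f (?g x) = x" for x
    using assms by (auto simp: thompson_gen_def field_simps)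
  then have "surj ?f"
    by (rule surjI)
  moreover have "strict_mono ?f"
    using assms by (auto simp: strict_mono_def thompson_gen_def)
  ultimately have "?f \<in> IncBij"
    by (simp add: IncBij_def)
  moreover have "supp ?f \<subseteq> {0<..<1}"
    using assms by (auto simp: supp_on_def thompson_gen_def split: if_splits)
  moreover have "\<exists>B. finite B \<and> B \<subseteq> dyadics \<inter> {0..1} \<and> dyadic_affine_off B ?f"
  proof (intro exI conjI)
    let ?B = "{1 - 4 * h, 1 - 2 * h, 1 - h}"
    have "2 * h \<in> dyadics" "4 * h \<in> dyadics"
      using dyadics_scale[OF assms(3), of 1] dyadics_scale[OF assms(3), of 2] by auto
    then show "?B \<subseteq> dyadics \<inter> {0..1}"
      using assms real_in_dyadics[of 1] by (auto intro!: dyadics_diff)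
    show "dyadic_affine_off ?B ?f"
      unfolding dyadic_affine_off_def
    proof (intro allI impI, elim conjE)
      fix a b :: real
      assume ab: "0 \<le> a" "a < b" "b \<le> 1" "{a<..<b} \<inter> ?B = {}"
      then have *: "v \<le> a \<or> b \<le> v" if "v \<in> ?B" for v
        using that by force
      consider "b \<le> 1 - 4 * h" | "1 - 4 * h \<le> a" "b \<le> 1 - 2 * h"
        | "1 - 2 * h \<le> a" "b \<le> 1 - h" | "1 - h \<le> a"
        using * by auto
      then show "\<exists>k c. \<forall>x\<in>{a<..<b}. ?f x = 2 powi k * x + c"
      proof cases
        case 1
        then show ?thesis
          by (intro exI[of _ 0]) (auto simp: thompson_gen_def)
      next
        case 2
        then show ?thesis
          by (intro exI[of _ "-1"] exI[of _ "(1 - 4 * h) / 2"])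
            (auto simp: thompson_gen_def field_simps)
      next
        case 3
        then show ?thesis
          using assms by (intro exI[of _ 0] exI[of _ "- h"]) (auto simp: thompson_gen_def)
      next
        case 4
        then show ?thesis
          using assms ab by (intro exI[of _ 1] exI[of _ "-1"]) (auto simp: thompson_gen_def)
      qed
    qed
  qed simp
  ultimately show ?thesis
    unfolding Thompson_F_iff by blast
qed

lemma Thompson_F_nonabelian:
  obtains a b where "a \<in> Thompson_F" "b \<in> Thompson_F" "a \<circ> b \<noteq> b \<circ> a"
proof
  have "1 / 4 \<in> (dyadics :: real set)" "1 / 8 \<in> (dyadics :: real set)"
    using dyadics_scale[of 1 "-2"] dyadics_scale[of 1 "-3"] real_in_dyadics[of 1]
    by (simp_all add: power_int_minus)
  then show "thompson_gen (1/4) \<in> Thompson_F" "thompson_gen (1/8) \<in> Thompson_F"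
    by (auto intro: thompson_gen_in_Thompson_F)
  \<comment> \<open>The two composites take the values 3/8 and 1/2 at 3/4.\<close>
  have "(thompson_gen (1/4) \<circ> thompson_gen (1/8)) (3/4) \<noteq> (thompson_gen (1/8) \<circ> thompson_gen (1/4)) (3/4)"
    by (simp add: thompson_gen_def)
  then show "thompson_gen (1/4) \<circ> thompson_gen (1/8) \<noteq> thompson_gen (1/8) \<circ> thompson_gen (1/4)"
    by metis
qed

section \<open>One step of the tower\<close>

lemma pow_SymR:
  assumes "t \<in> IncBij"
  shows "t [^]\<^bsub>SymR\<^esub> (p + q :: int) = (t [^]\<^bsub>SymR\<^esub> p) \<circ> (t [^]\<^bsub>SymR\<^esub> q)"
    "t [^]\<^bsub>SymR\<^esub> (p :: int) \<in> IncBij"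
proof -
  have t: "t \<in> carrier SymR"
    using IncBijD(1)[OF assms] by (simp add: carrier_SymR)
  have bij: "bij (t [^]\<^bsub>SymR\<^esub> (p :: int))" for p
    using SymR.int_pow_closed[OF t, of p] by (simp add: carrier_SymR)
  then show "t [^]\<^bsub>SymR\<^esub> (p + q :: int) = (t [^]\<^bsub>SymR\<^esub> p) \<circ> (t [^]\<^bsub>SymR\<^esub> q)"
    by (simp add: SymR.int_pow_mult[OF t] mult_SymR)
  have nat: "t [^]\<^bsub>SymR\<^esub> n \<in> IncBij" for n :: nat
  proof (induction n)
    case 0
    show ?case
      by (simp only: nat_pow_0 one_SymR IncBij_id)
  next
    case (Suc n)
    then show ?case
      using IncBij_comp[OF Suc assms] by (simp only: nat_pow_Suc mult_SymR IncBijD(1) assms)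
  qed
  show "t [^]\<^bsub>SymR\<^esub> (p :: int) \<in> IncBij"
  proof (cases p rule: int_cases2)
    case (nonneg n)
    then show ?thesis
      by (simp add: int_pow_int nat)
  next
    case (nonpos n)
    then show ?thesis
      using IncBij_inv[OF nat[of n]] by (simp add: SymR.int_pow_neg_int[OF t] inv_SymR IncBijD(1)[OF nat])
  qed
qed

text \<open>With \<open>J\<close> = I_i and \<open>H\<close> = G_i these are the invariants carried
  up the tower: results proved here give them again for \<open>supp t\<close> and the group
  generated at the next stage.\<close>

locale tower_step =
  fixes t :: "real \<Rightarrow> real" and J :: "real set" and H :: "(real \<Rightarrow> real) set"
  assumes t_Homeo_c: "t \<in> Homeo_c"
    and displaces: "t ` J \<inter> J = {}"
    and J_nonempty: "J \<noteq> {}"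
    and J_connected: "connected J"
    and H_subgroup: "subgroup H SymR"
    and H_IncBij: "H \<subseteq> IncBij"
    and H_supp: "h \<in> H \<Longrightarrow> supp h \<subseteq> J"
begin

section \<open>Powers of t and the translates of J\<close>

abbreviation P :: "int \<Rightarrow> real \<Rightarrow> real"
  where "P p \<equiv> t [^]\<^bsub>SymR\<^esub> p"

abbreviation Om :: "(real \<Rightarrow> real) set"
  where "Om \<equiv> omega_group t J H"

abbreviation G' :: "(real \<Rightarrow> real) set"
  where "G' \<equiv> generate SymR (Om \<union> {t})"

lemma t_IncBij: "t \<in> IncBij"
  by (rule Homeo_c_IncBij[OF t_Homeo_c])

lemma P_IncBij: "P p \<in> IncBij"
  by (rule pow_SymR(2)[OF t_IncBij])

lemmas P = IncBijD[OF P_IncBij]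

lemma P_add: "P p (P q x) = P (p + q) x"
  by (simp add: pow_SymR(1)[OF t_IncBij])

lemma P_0: "P 0 = id"
  by simp

lemma P_1: "P 1 = t"
  using IncBijD(1)[OF t_IncBij] by (simp add: carrier_SymR)

lemma finv_P: "finv (P p) = P (- p)"
proof
  fix x
  have "P p (finv (P p) x) = P p (P (- p) x)"
    by (simp add: P P_add)
  then show "finv (P p) x = P (- p) x"
    by (simp only: P(4))
qed

lemma H_closed:
  "id \<in> H" "g \<in> H \<Longrightarrow> h \<in> H \<Longrightarrow> g \<circ> h \<in> H" "h \<in> H \<Longrightarrow> finv h \<in> H"
  using H_subgroup by (auto simp: subgroup_SymR_iff)

lemma H_D:
  assumes "h \<in> H"
  shows "h \<in> IncBij" "x \<in> J \<Longrightarrow> h x \<in> J" "x \<notin> J \<Longrightarrow> h x = x"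
    "finv h (h x) = x" "h (finv h x) = x"
proof -
  show h: "h \<in> IncBij"
    using assms H_IncBij by blast
  show "x \<in> J \<Longrightarrow> h x \<in> J"
    by (rule bij_maps_into[OF IncBijD(1)[OF h] H_supp[OF assms]])
  show "x \<notin> J \<Longrightarrow> h x = x"
    by (rule supp_outside[OF H_supp[OF assms]])
  show "finv h (h x) = x" "h (finv h x) = x"
    by (simp_all add: IncBijD[OF h])
qed

text \<open>Orbits of the increasing map \<open>t\<close> are monotone, so \<open>t x\<close> lies
  between \<open>x\<close> and its image under the power. If both were in the interval
  \<open>J\<close>, so would be \<open>t x\<close>.\<close>

lemma P_escapes:
  assumes "x \<in> J" "n > 0"
  shows "P (int n) x \<notin> J"
proof
  assume y: "P (int n) x \<in> J"
  have tx: "t x \<notin> J"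
    using assms displaces by blast
  have P_Suc: "P (int (Suc m)) x = t (P (int m) x)" for m
    using P_add[of 1 "int m" x] P_1 by (simp add: add.commute)
  note T = IncBijD(2,3)[OF t_IncBij]
  have "t x \<noteq> x"
    using tx assms by metis
  then consider "x < t x" | "t x < x"
    by linarith
  then show False
  proof cases
    case 1
    have "x \<le> P (int m) x \<and> t x \<le> P (int (Suc m)) x" for m
    proof (induction m)
      case 0
      show ?case
        by (simp add: P_Suc[of 0, simplified])
    next
      case (Suc m)
      then have "x \<le> P (int (Suc m)) x"
        using 1 by linarith
      then show ?case
        by (simp only: P_Suc[of "Suc m"] T)
    qed
    from this[of "n - 1"] have "t x \<le> P (int n) x"
      using \<open>n > 0\<close> by simp
    then show False
      using connectedD_interval[OF J_connected assms(1) y, of "t x"] 1 tx by simp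
  next
    case 2
    have "P (int m) x \<le> x \<and> P (int (Suc m)) x \<le> t x" for m
    proof (induction m)
      case 0
      show ?case
        by (simp add: P_Suc[of 0, simplified])
    next
      case (Suc m)
      then have "P (int (Suc m)) x \<le> x"
        using 2 by linarith
      then show ?case
        by (simp only: P_Suc[of "Suc m"] T)
    qed
    from this[of "n - 1"] have "P (int n) x \<le> t x"
      using \<open>n > 0\<close> by simp
    then show False
      using connectedD_interval[OF J_connected y assms(1), of "t x"] 2 tx by simp
  qed
qed

text \<open>This makes \<open>(p, x)\<close> coordinates on the union of the translates. Points
  coinciding for different exponents would let a positive power of \<open>t\<close> send a point of
  \<open>J\<close> back into \<open>J\<close>.\<close>

lemma P_inj:
  assumes "x \<in> J" "y \<in> J" "P p x = P q y"
  shows "p = q" "x = y"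
proof -
  have x: "x = P (q - p) y"
    using arg_cong[OF assms(3), of "P (- p)"] by (simp add: P_add)
  have y: "y = P (p - q) x"
    using arg_cong[OF assms(3), of "P (- q)"] by (simp add: P_add)
  show "p = q"
  proof (rule ccontr)
    assume "p \<noteq> q"
    then consider "p < q" | "q < p"
      by linarith
    then show False
    proof cases
      case 1
      then show False
        using P_escapes[OF assms(2), of "nat (q - p)"] x assms(1) by simp
    next
      case 2
      then show False
        using P_escapes[OF assms(1), of "nat (p - q)"] y assms(2) by simp
    qed
  qed
  with x show "x = y"
    by simp
qed

lemma P_in_supp:
  assumes "x \<in> J"
  shows "P p x \<in> supp t"
proof -
  have "t x \<noteq> x"
    using displaces assms by (metis disjoint_iff imageI)
  moreover have "t (P p x) = P p (t x)"
    using P_add[of 1 p x] P_add[of p 1 x] P_1 by (simp add: add.commute)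
  ultimately show ?thesis
    by (simp add: supp_on_def P(4))
qed

lemma J_subset_supp: "J \<subseteq> supp t"
  using P_in_supp[of _ 0] by auto

text \<open>The working form of membership: in the coordinates \<open>(p, x)\<close> the conjugate
  of \<open>h\<close> by \<open>P p\<close> is \<open>h\<close> acting on \<open>x\<close>.
  Continuity becomes monotonicity because the translates lie in the bounded set
  \<open>supp t\<close>.\<close>

lemma Om_iff:
  "g \<in> Om \<longleftrightarrow> g \<in> IncBij \<and> supp g \<subseteq> (\<Union>p. P p ` J) \<and>
    (\<forall>p. \<exists>h\<in>H. \<forall>x\<in>J. g (P p x) = P p (h x))"
proof -
  have "(\<Union>p. P p ` J) \<subseteq> supp t"
    using P_in_supp by blast
  then have "bounded (\<Union>p. P p ` J)"
    by (rule bounded_subset[OF Homeo_c_IncBij(2)[OF t_Homeo_c]])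
  then have "g \<in> IncBij" if "g \<in> Homeo" "supp g \<subseteq> (\<Union>p. P p ` J)" for g
    by (rule Homeo_bounded_supp_IncBij[OF that(1) bounded_subset[OF _ that(2)]])
  moreover have "(\<exists>h\<in>conjugate SymR (P p) ` H. \<forall>x\<in>P p ` J. g x = h x) \<longleftrightarrow>
      (\<exists>h\<in>H. \<forall>x\<in>J. g (P p x) = P p (h x))" for p
  proof -
    have "conjugate SymR (P p) h (P p x) = P p (h x)" if "h \<in> H" for h x
      using IncBijD(1)[OF H_D(1)[OF that]] by (simp add: conjugate_SymR P)
    then show ?thesis
      by simp
  qed
  ultimately show ?thesis
    unfolding omega_group_def translate_def using IncBij_imp_Homeo by auto
qed

lemma Om_D:
  assumes "g \<in> Om"
  obtains h where "h \<in> H" "\<And>x. x \<in> J \<Longrightarrow> g (P p x) = P p (h x)"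
  using assms unfolding Om_iff by blast

lemma Om_I:
  assumes "g \<in> IncBij" "\<And>x. (\<And>p y. y \<in> J \<Longrightarrow> x \<noteq> P p y) \<Longrightarrow> g x = x"
    "\<And>p. \<exists>h\<in>H. \<forall>x\<in>J. g (P p x) = P p (h x)"
  shows "g \<in> Om"
  using assms unfolding Om_iff by (force simp: supp_on_def)

lemma Om_outside: "g \<in> Om \<Longrightarrow> (\<And>p y. y \<in> J \<Longrightarrow> x \<noteq> P p y) \<Longrightarrow> g x = x"
  by (rule supp_outside[of _ "\<Union>p. P p ` J"]) (auto simp: Om_iff)

lemma Om_id: "id \<in> Om"
  by (rule Om_I) (use H_closed(1) in \<open>auto intro!: bexI[of _ id]\<close>)

lemma Om_comp:
  assumes "f \<in> Om" "g \<in> Om"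
  shows "f \<circ> g \<in> Om"
proof (rule Om_I)
  show "f \<circ> g \<in> IncBij"
    using assms by (auto simp: Om_iff)
  show "(f \<circ> g) x = x" if "\<And>p y. y \<in> J \<Longrightarrow> x \<noteq> P p y" for x
    using Om_outside[OF assms(1) that] Om_outside[OF assms(2) that] by simp
  fix p
  obtain h where h: "h \<in> H" "\<And>x. x \<in> J \<Longrightarrow> g (P p x) = P p (h x)"
    using Om_D[OF assms(2)] by metis
  obtain k where k: "k \<in> H" "\<And>x. x \<in> J \<Longrightarrow> f (P p x) = P p (k x)"
    using Om_D[OF assms(1)] by metis
  show "\<exists>h\<in>H. \<forall>x\<in>J. (f \<circ> g) (P p x) = P p (h x)"
    using h k H_closed(2)[OF k(1) h(1)] H_D(2)[OF h(1)] by (intro bexI[of _ "k \<circ> h"]) auto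
qed

lemma Om_inv:
  assumes "f \<in> Om"
  shows "finv f \<in> Om"
proof (rule Om_I)
  have f: "f \<in> IncBij"
    using assms by (auto simp: Om_iff)
  then show "finv f \<in> IncBij"
    by blast
  show "finv f x = x" if "\<And>p y. y \<in> J \<Longrightarrow> x \<noteq> P p y" for x
    using Om_outside[OF assms(1) that] IncBijD(5)[OF f, of x] by simp
  fix p
  obtain h where h: "h \<in> H" "\<And>x. x \<in> J \<Longrightarrow> f (P p x) = P p (h x)"
    using Om_D[OF assms(1)] by metis
  have "finv f (P p x) = P p (finv h x)" if "x \<in> J" for x
  proof -
    have "f (P p (finv h x)) = P p x"
      using h(2)[OF H_D(2)[OF H_closed(3)[OF h(1)] that]] H_D(5)[OF h(1)] by simp
    then show ?thesis
      using IncBijD(5)[OF f] by metis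
  qed
  then show "\<exists>h\<in>H. \<forall>x\<in>J. finv f (P p x) = P p (h x)"
    using H_closed(3)[OF h(1)] by blast
qed

text \<open>Conjugation by \<open>P n\<close> shifts the factors: the one at \<open>p\<close> is
  that of \<open>f\<close> at \<open>p - n\<close>.\<close>

lemma Om_conj:
  assumes "f \<in> Om"
  shows "P n \<circ> f \<circ> P (- n) \<in> Om"
proof (rule Om_I)
  show "P n \<circ> f \<circ> P (- n) \<in> IncBij"
    using assms P_IncBij by (intro IncBij_comp) (simp_all add: Om_iff)
  show "(P n \<circ> f \<circ> P (- n)) x = x" if x: "\<And>p y. y \<in> J \<Longrightarrow> x \<noteq> P p y" for x
  proof -
    have "P (- n) x \<noteq> P p y" if "y \<in> J" for p y
    proof
      assume "P (- n) x = P p y"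
      then have "P n (P (- n) x) = P (n + p) y"
        by (simp only: P_add)
      then show False
        using x[OF that] by (simp add: P_add)
    qed
    then show ?thesis
      using Om_outside[OF assms] by (simp add: P_add)
  qed
  fix p
  obtain h where h: "h \<in> H" "\<And>x. x \<in> J \<Longrightarrow> f (P (p - n) x) = P (p - n) (h x)"
    using Om_D[OF assms(1)] by metis
  then have "(P n \<circ> f \<circ> P (- n)) (P p x) = P p (h x)" if "x \<in> J" for x
    using that by (simp add: P_add)
  then show "\<exists>h\<in>H. \<forall>x\<in>J. (P n \<circ> f \<circ> P (- n)) (P p x) = P p (h x)"
    using h(1) by blast
qed

text \<open>\<open>H\<close> is the factor at 0; its elements have identity factors elsewhere, since
  the other translates miss \<open>J\<close>.\<close>

lemma H_subset_Om: "H \<subseteq> Om"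
proof
  fix h
  assume h: "h \<in> H"
  show "h \<in> Om"
  proof (rule Om_I)
    show "h \<in> IncBij"
      by (rule H_D(1)[OF h])
    show "h x = x" if "\<And>p y. y \<in> J \<Longrightarrow> x \<noteq> P p y" for x
      using H_D(3)[OF h, of x] that[of x 0] by auto
    fix p
    show "\<exists>k\<in>H. \<forall>x\<in>J. h (P p x) = P p (k x)"
    proof (cases "p = 0")
      case True
      then show ?thesis
        using h by auto
    next
      case False
      then have "P p x \<notin> J" if "x \<in> J" for x
        using P_inj(1)[OF that, of "P p x" p 0] by auto
      then show ?thesis
        using H_D(3)[OF h] H_closed(1) by (intro bexI[of _ id]) auto
    qed
  qed
qed

text \<open>The wreath product decomposition: \<open>\<langle>t\<rangle>\<close> normalises the base group.\<close>

lemma subgroup_Om_powers: "subgroup {f \<circ> P n | f n. f \<in> Om} SymR" (is "subgroup ?K SymR")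
  unfolding subgroup_SymR_iff
proof (intro conjI ballI)
  have inc: "f \<in> IncBij" if "f \<in> Om" for f
    using that by (auto simp: Om_iff)
  show "bij k" if "k \<in> ?K" for k
    using that inc IncBijD(1) P_IncBij by blast
  show "id \<in> ?K"
    using Om_id P_0 by (metis (mono_tags, lifting) comp_id mem_Collect_eq)
  show "k \<circ> l \<in> ?K" if kl: "k \<in> ?K" "l \<in> ?K" for k l
  proof -
    obtain f m where *: "f \<in> Om" "k = f \<circ> P m"
      using kl(1) by blast
    obtain g n where **: "g \<in> Om" "l = g \<circ> P n"
      using kl(2) by blast
    have "k \<circ> l = (f \<circ> (P m \<circ> g \<circ> P (- m))) \<circ> P (m + n)"
      by (auto simp: *(2) **(2) P_add)
    then show ?thesis
      using Om_comp[OF *(1) Om_conj[OF **(1)]] by blast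
  qed
  show "finv k \<in> ?K" if k: "k \<in> ?K" for k
  proof -
    obtain f n where *: "f \<in> Om" "k = f \<circ> P n"
      using k by blast
    have "finv k = P (- n) \<circ> finv f"
      using IncBijD(1)[OF inc[OF *(1)]] by (simp add: *(2) o_inv_distrib P(1) finv_P)
    also have "\<dots> = (P (- n) \<circ> finv f \<circ> P (- (- n))) \<circ> P (- n)"
      by (auto simp: P_add)
    finally show ?thesis
      using Om_conj[OF Om_inv[OF *(1)]] by blast
  qed
qed

section \<open>The group generated by the product and t\<close>

lemma Om_bij: "f \<in> Om \<Longrightarrow> bij f"
  by (simp add: Om_iff IncBijD(1))

lemma generators_carrier: "Om \<union> {t} \<subseteq> carrier SymR"
  using Om_bij IncBijD(1)[OF t_IncBij] by (auto simp: carrier_SymR)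

lemma subgroup_G': "subgroup G' SymR"
  by (rule SymR.generate_is_subgroup[OF generators_carrier])

lemma Om_subset_G': "Om \<subseteq> G'" and t_in_G': "t \<in> G'"
  by (auto intro: generate.incl)

lemma G'_decomp:
  assumes "g \<in> G'"
  obtains f n where "f \<in> Om" "g = f \<circ> P n"
proof -
  have "f \<in> {f \<circ> P n | f n. f \<in> Om}" if "f \<in> Om" for f
    using that P_0 by (metis (mono_tags, lifting) comp_id mem_Collect_eq)
  moreover have "t \<in> {f \<circ> P n | f n. f \<in> Om}"
    using Om_id P_1 by (metis (mono_tags, lifting) id_comp mem_Collect_eq)
  ultimately have "G' \<subseteq> {f \<circ> P n | f n. f \<in> Om}"
    by (intro SymR.generate_subgroup_incl subgroup_Om_powers) blast
  then show thesis
    using assms that by blast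
qed

lemma G'_IncBij: "G' \<subseteq> IncBij"
proof
  fix g
  assume "g \<in> G'"
  then show "g \<in> IncBij"
    by (elim G'_decomp) (auto simp: Om_iff P_IncBij)
qed

lemma G'_supp:
  assumes "g \<in> G'"
  shows "supp g \<subseteq> supp t"
proof -
  obtain f n where g: "f \<in> Om" "g = f \<circ> P n"
    using assms by (elim G'_decomp)
  have nat: "P (int m) x = x" if "t x = x" for m x
  proof (induction m)
    case (Suc m)
    then show ?case
      using P_add[of 1 "int m" x] P_1 that by simp
  qed simp
  have "P n x = x" if "t x = x" for x
  proof (cases n rule: int_cases2)
    case (nonneg m)
    then show ?thesis
      using nat that by simp
  next
    case (nonpos m)
    then show ?thesis
      using nat[OF that, of m] P_add[of "- int m" "int m" x] by simp
  qed
  then have "supp (P n) \<subseteq> supp t"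
    by (auto simp: supp_on_def)
  moreover have "supp f \<subseteq> supp t"
    using g(1) P_in_supp unfolding Om_iff by blast
  ultimately show ?thesis
    unfolding g by (intro supp_comp_subset)
qed

text \<open>In \<open>g = f \<circ> P n\<close> the map \<open>f\<close> keeps every translate, so
  \<open>g\<close> sends \<open>J\<close> into the translate with index \<open>n\<close>, which is
  disjoint from \<open>J\<close> unless \<open>n = 0\<close>.\<close>

lemma G'_block:
  assumes "g \<in> G'"
  shows "g ` J \<inter> J = {} \<or> (\<exists>h\<in>H. \<forall>x\<in>J. g x = h x)"
proof -
  obtain f n where g: "f \<in> Om" "g = f \<circ> P n"
    using assms by (elim G'_decomp)
  obtain h where h: "h \<in> H" "\<And>x. x \<in> J \<Longrightarrow> f (P n x) = P n (h x)"
    using Om_D[OF g(1)] by metis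
  show ?thesis
  proof (cases "n = 0")
    case True
    then show ?thesis
      using h g by auto
  next
    case False
    have "g x \<notin> J" if "x \<in> J" for x
    proof
      assume "g x \<in> J"
      moreover have "P n (h x) = P 0 (g x)"
        using h(2)[OF that] by (simp add: g P_0)
      ultimately show False
        using P_inj(1)[OF H_D(2)[OF h(1) that]] False by blast
    qed
    then show ?thesis
      by blast
  qed
qed

text \<open>A bijection supported on the nonempty set \<open>J\<close> keeps it, which excludes the
  first alternative of \<open>G'_block\<close>; the element of \<open>H\<close> from the second one
  agrees with \<open>g\<close> off \<open>J\<close> as well.\<close>

lemma G'_supported_on_J:
  assumes "g \<in> G'" "supp g \<subseteq> J"
  shows "g \<in> H"
proof -
  obtain x where x: "x \<in> J"
    using J_nonempty by blast
  have "bij g"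
    using G'_IncBij assms(1) IncBijD(1) by blast
  then have "g x \<in> J"
    using bij_maps_into assms(2) x by blast
  with x G'_block[OF assms(1)] obtain h where h: "h \<in> H" "\<And>x. x \<in> J \<Longrightarrow> g x = h x"
    by blast
  have "g y = h y" for y
    using h supp_outside[OF assms(2), of y] H_D(3)[OF h(1), of y] by (cases "y \<in> J") auto
  then have "g = h"
    by blast
  with h show ?thesis
    by simp
qed

text \<open>The infinite product of the conjugates of \<open>h\<close> by \<open>P p\<close> for
  \<open>p \<ge> 1\<close>, which a dissipator has to provide. \<open>P_inj\<close> makes the
  description under \<open>THE\<close> unique.\<close>

definition spread :: "(real \<Rightarrow> real) \<Rightarrow> real \<Rightarrow> real"
  where "spread h y =
    (if \<exists>p x. 1 \<le> p \<and> x \<in> J \<and> y = P p x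
     then THE z. \<exists>p x. 1 \<le> p \<and> x \<in> J \<and> y = P p x \<and> z = P p (h x) else y)"

lemma spread_in: "1 \<le> p \<Longrightarrow> x \<in> J \<Longrightarrow> spread h (P p x) = P p (h x)"
  unfolding spread_def
  by (subst if_P, blast, rule the_equality) (blast, metis P_inj)

lemma spread_out: "(\<And>p x. 1 \<le> p \<Longrightarrow> x \<in> J \<Longrightarrow> y \<noteq> P p x) \<Longrightarrow> spread h y = y"
  unfolding spread_def by auto

text \<open>Disjoint intervals are ordered as wholes, so moving each point within its own interval
  cannot reverse the order.\<close>

lemma disjoint_connected_less:
  fixes a b :: real
  assumes "connected A" "connected B" "A \<inter> B = {}" "a \<in> A" "a' \<in> A" "b \<in> B" "b' \<in> B" "a < b"
  shows "a' < b'"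
proof (rule ccontr)
  assume "\<not> a' < b'"
  then consider "b' \<le> a" | "a \<le> b'" "b' \<le> a'"
    by linarith
  then show False
  proof cases
    case 1
    then show False
      using connectedD_interval[OF assms(2) assms(7,6), of a] assms by auto
  next
    case 2
    then show False
      using connectedD_interval[OF assms(1) assms(4,5), of b'] assms by auto
  qed
qed

lemma connected_translate: "connected (P p ` J)"
  by (rule connected_continuous_image[OF IncBij_continuous[OF P_IncBij] J_connected])

text \<open>The infinite product of conjugates is a homeomorphism, even at the accumulation points
  of the intervals, because it is an order-preserving bijection.\<close>

lemma spread_IncBij:
  assumes "h \<in> H"
  shows "spread h \<in> IncBij"
proof -
  \<comment> \<open>The sets \<open>C y\<close> partition the line into the translates with
    \<open>p \<ge> 1\<close> and single points. All are connected and kept by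
    \<open>spread h\<close>, so monotonicity is needed only inside one block, where it is that of
    \<open>h\<close>.\<close>
  define C where "C y = (if \<exists>p x. 1 \<le> p \<and> x \<in> J \<and> y = P p x
    then P (THE p. 1 \<le> p \<and> y \<in> P p ` J) ` J else {y})" for y
  have C_in: "C (P p x) = P p ` J" if "1 \<le> p" "x \<in> J" for p x
  proof -
    have "(THE q. 1 \<le> q \<and> P p x \<in> P q ` J) = p"
      using that by (intro the_equality) (auto dest: P_inj(1)[rotated 2])
    then show ?thesis
      using that unfolding C_def by auto
  qed
  have C_out: "C y = {y}" if "\<And>p x. 1 \<le> p \<Longrightarrow> x \<in> J \<Longrightarrow> y \<noteq> P p x" for y
    using that unfolding C_def by auto
  have mem: "connected (C y)" "y \<in> C y" "spread h y \<in> C y" for y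
  proof -
    have "connected (C y) \<and> y \<in> C y \<and> spread h y \<in> C y"
    proof (cases "\<exists>p x. 1 \<le> p \<and> x \<in> J \<and> y = P p x")
      case True
      then show ?thesis
        using C_in H_D(2)[OF assms] connected_translate by (auto simp: spread_in)
    next
      case False
      then show ?thesis
        using C_out[of y] spread_out[of y] by auto
    qed
    then show "connected (C y)" "y \<in> C y" "spread h y \<in> C y"
      by auto
  qed
  have C_mem: "C z = C y" if "z \<in> C y" for y z
  proof (cases "\<exists>p x. 1 \<le> p \<and> x \<in> J \<and> y = P p x")
    case True
    then show ?thesis
      using C_in that by auto
  next
    case False
    then show ?thesis
      using C_out[of y] that by auto
  qed
  have "spread h y < spread h z" if "y < z" for y z
  proof (cases "z \<in> C y")
    case True
    then have "C y \<noteq> {y}"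
      using that by auto
    then obtain p x where y: "1 \<le> p" "x \<in> J" "y = P p x"
      using C_out[of y] by blast
    then obtain x' where "x' \<in> J" "z = P p x'"
      using True C_in by auto
    then show ?thesis
      using that y by (simp add: spread_in P(2) IncBijD(2)[OF H_D(1)[OF assms]])
  next
    case False
    then have "C y \<inter> C z = {}"
      using C_mem mem(2) by blast
    then show ?thesis
      using disjoint_connected_less[OF mem(1) mem(1) _ mem(2,3) mem(2,3) that] by blast
  qed
  moreover have "spread h (spread (finv h) y) = y" for y
  proof (cases "\<exists>p x. 1 \<le> p \<and> x \<in> J \<and> y = P p x")
    case True
    then show ?thesis
      using H_D(2)[OF H_closed(3)[OF assms]] H_D(5)[OF assms] by (auto simp: spread_in)
  next
    case False
    then have "spread k y = y" for k
      by (intro spread_out) blast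
    then show ?thesis
      by simp
  qed
  then have "surj (spread h)"
    by (rule surjI)
  ultimately show ?thesis
    by (simp add: IncBij_def strict_mono_def)
qed

text \<open>The factors are \<open>h\<close> for \<open>p \<ge> 1\<close> and the identity
  otherwise; an unrestricted product admits this family.\<close>

lemma spread_Om:
  assumes "h \<in> H"
  shows "spread h \<in> Om"
proof (rule Om_I)
  show "spread h \<in> IncBij"
    by (rule spread_IncBij[OF assms])
  show "spread h x = x" if "\<And>p y. y \<in> J \<Longrightarrow> x \<noteq> P p y" for x
    using that by (intro spread_out)
  fix p
  show "\<exists>k\<in>H. \<forall>x\<in>J. spread h (P p x) = P p (k x)"
  proof (cases "1 \<le> p")
    case True
    then show ?thesis
      using assms spread_in by blast
  next
    case False
    then have "spread h (P p x) = P p x" if "x \<in> J" for x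
      using P_inj(1)[OF that] by (intro spread_out) blast
    then show ?thesis
      using H_closed(1) by (intro bexI[of _ id]) auto
  qed
qed

end

section \<open>Commuting conjugates in abstract groups\<close>

context group
begin

lemma conjugate_closed: "g \<in> carrier G \<Longrightarrow> x \<in> carrier G \<Longrightarrow> conjugate G g x \<in> carrier G"
  by (simp add: conjugate_def)

lemma conjugate_mult:
  assumes "g \<in> carrier G" "x \<in> carrier G" "y \<in> carrier G"
  shows "conjugate G g (x \<otimes> y) = conjugate G g x \<otimes> conjugate G g y"
proof -
  have "inv g \<otimes> (g \<otimes> (y \<otimes> inv g)) = y \<otimes> inv g"
    using assms by (simp add: m_assoc[symmetric])
  then show ?thesis
    using assms by (simp add: conjugate_def m_assoc)
qed

lemma conjugate_conjugate:
  "g \<in> carrier G \<Longrightarrow> h \<in> carrier G \<Longrightarrow> x \<in> carrier G \<Longrightarrow>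
    conjugate G g (conjugate G h x) = conjugate G (g \<otimes> h) x"
  by (simp add: conjugate_def m_assoc inv_mult_group)

lemma commutator_one_imp_commute:
  assumes "a \<in> carrier G" "b \<in> carrier G" "a \<otimes> b \<otimes> inv a \<otimes> inv b = \<one>"
  shows "a \<otimes> b = b \<otimes> a"
proof -
  have "a \<otimes> b \<otimes> inv (b \<otimes> a) = \<one>"
    using assms by (simp add: inv_mult_group m_assoc)
  then show ?thesis
    using assms by (metis inv_equality inv_inv m_closed inv_closed)
qed

text \<open>The subgroup \<open>\<Lambda>\<close> is eliminated by conjugating it and \<open>t\<close> simultaneously.\<close>

lemma commuting_Z_conjugates_imp:
  assumes "commuting_Z_conjugates G"
  shows "\<exists>s\<in>carrier G. \<forall>S. finite S \<and> S \<subseteq> carrier G \<longrightarrow> (\<exists>g\<in>carrier G. \<forall>u\<in>S. \<forall>v\<in>S.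
      u \<otimes> conjugate G (conjugate G g s) v = conjugate G (conjugate G g s) v \<otimes> u)"
proof -
  from assms obtain L s where L: "subgroup L G" and s: "s \<in> carrier G"
    and comm: "\<forall>p::nat. p \<ge> 1 \<longrightarrow> (\<forall>a\<in>L. \<forall>b\<in>conjugate G (s [^] p) ` L.
      a \<otimes> b \<otimes> inv a \<otimes> inv b = \<one>)"
    and fin: "\<forall>S. finite S \<and> S \<subseteq> carrier G \<longrightarrow> (\<exists>g\<in>carrier G. S \<subseteq> conjugate G g ` L)"
    unfolding commuting_Z_conjugates_def by (elim exE conjE)
  have L_carrier: "a \<in> carrier G" if "a \<in> L" for a
    using L that by (rule subgroup.mem_carrier)
  have comm': "a \<otimes> conjugate G s b = conjugate G s b \<otimes> a" if "a \<in> L" "b \<in> L" for a b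
    using comm[rule_format, of 1 a "conjugate G s b"] that s L_carrier
    by (intro commutator_one_imp_commute) (simp_all add: conjugate_closed)
  show ?thesis
  proof (rule bexI[OF _ s], intro allI impI)
    fix S
    assume "finite S \<and> S \<subseteq> carrier G"
    then obtain g where g: "g \<in> carrier G" "S \<subseteq> conjugate G g ` L"
      using fin by blast
    have "u \<otimes> conjugate G (conjugate G g s) v = conjugate G (conjugate G g s) v \<otimes> u"
      if uv: "u \<in> S" "v \<in> S" for u v
    proof -
      obtain a b where ab: "a \<in> L" "b \<in> L" "u = conjugate G g a" "v = conjugate G g b"
        using uv g by blast
      note c = L_carrier[OF ab(1)] L_carrier[OF ab(2)] s g(1)
      \<comment> \<open>Conjugation by \<open>g\<close> carries the action of \<open>s\<close> on
        \<open>L\<close> to that of \<open>conjugate G g s\<close> on the conjugate of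
        \<open>L\<close>, and with it the commutation.\<close>
      have "conjugate G g s \<otimes> g = g \<otimes> s"
        using c by (simp add: conjugate_def m_assoc)
      then have "conjugate G (conjugate G g s) v = conjugate G g (conjugate G s b)"
        using c by (simp add: ab conjugate_conjugate conjugate_closed)
      then show ?thesis
        using c comm'[OF ab(1,2)] by (simp add: ab conjugate_mult[symmetric] conjugate_closed)
    qed
    then show "\<exists>g\<in>carrier G. \<forall>u\<in>S. \<forall>v\<in>S.
      u \<otimes> conjugate G (conjugate G g s) v = conjugate G (conjugate G g s) v \<otimes> u"
      using g(1) by blast
  qed
qed

end

section \<open>The limit group\<close>

locale tower =
  fixes t :: "nat \<Rightarrow> real \<Rightarrow> real"
  assumes admissible: "admissible_choice t"
begin

abbreviation I :: "nat \<Rightarrow> real set"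
  where "I \<equiv> tower_interval t"

abbreviation Gr :: "nat \<Rightarrow> (real \<Rightarrow> real) set"
  where "Gr \<equiv> tower_group t"

abbreviation L :: "(real \<Rightarrow> real) monoid"
  where "L \<equiv> limit_group t"

text \<open>The intervals need not exhaust the line, while a direct system must exhaust its set;
  hence the group is realised on this union.\<close>

definition X :: "real set"
  where "X = (\<Union>i. I i)"

lemma admissibleD:
  "t (Suc i) \<in> Homeo_c" "connected (supp (t (Suc i)))" "t (Suc i) ` I i \<inter> I i = {}"
  using admissible unfolding admissible_choice_def by blast+

lemma step_tower_step: "tower_step (t (Suc i)) (I i) (Gr i)"
proof (induction i)
  case 0
  show ?case
  proof (rule tower_step.intro)
    show "t (Suc 0) ` I 0 \<inter> I 0 = {}" "t (Suc 0) \<in> Homeo_c"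
      by (rule admissibleD)+
    show "I 0 \<noteq> {}" "connected (I 0)" "subgroup (Gr 0) SymR"
      using subgroup_Thompson_F by simp_all
    show "Gr 0 \<subseteq> IncBij"
      unfolding tower_group.simps using Thompson_F_iff by blast
    show "supp h \<subseteq> I 0" if "h \<in> Gr 0" for h
      using that by (simp add: Thompson_F_iff)
  qed
next
  case (Suc i)
  interpret tower_step "t (Suc i)" "I i" "Gr i"
    by (rule Suc)
  show ?case
  proof (rule tower_step.intro)
    show "t (Suc (Suc i)) ` I (Suc i) \<inter> I (Suc i) = {}" "t (Suc (Suc i)) \<in> Homeo_c"
      by (rule admissibleD)+
    show "I (Suc i) \<noteq> {}"
      using J_nonempty J_subset_supp by auto
    show "connected (I (Suc i))"
      using admissibleD(2) by simp
    show "subgroup (Gr (Suc i)) SymR" "Gr (Suc i) \<subseteq> IncBij"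
      unfolding tower_group.simps by (rule subgroup_G' G'_IncBij)+
    show "supp h \<subseteq> I (Suc i)" if "h \<in> Gr (Suc i)" for h
      using G'_supp that by simp
  qed
qed

sublocale S: tower_step "t (Suc i)" "I i" "Gr i" for i
  by (rule step_tower_step)

lemma I_mono: "i \<le> j \<Longrightarrow> I i \<subseteq> I j"
  by (rule lift_Suc_mono_le) (simp_all add: S.J_subset_supp)

lemma Gr_mono: "i \<le> j \<Longrightarrow> Gr i \<subseteq> Gr j"
proof (rule lift_Suc_mono_le)
  show "Gr n \<subseteq> Gr (Suc n)" for n
    using S.H_subset_Om[of n] S.Om_subset_G'[of n] by simp
qed

text \<open>Descent one stage at a time: while \<open>i \<le> j\<close>, the support lies in
  \<open>I j\<close>, and \<open>G'_supported_on_J\<close> leads from \<open>Gr (Suc j)\<close> to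
  \<open>Gr j\<close>.\<close>

lemma supported_in_stage:
  assumes "g \<in> Gr j" "supp g \<subseteq> I i"
  shows "g \<in> Gr i"
  using assms(1)
proof (induction j)
  case 0
  then show ?case
    using Gr_mono[of 0 i] by blast
next
  case (Suc j)
  show ?case
  proof (cases "Suc j \<le> i")
    case True
    then show ?thesis
      using Gr_mono Suc.prems by blast
  next
    case False
    then have "supp g \<subseteq> I j"
      using assms(2) I_mono[of i j] by auto
    then have "g \<in> Gr j"
      using S.G'_supported_on_J[of g j] Suc.prems by simp
    then show ?thesis
      by (rule Suc.IH)
  qed
qed

text \<open>Used to sort conjugating elements. Above stage \<open>i\<close>, an element that does
  not displace \<open>I j\<close> agrees on \<open>I j\<close>, hence on \<open>I i\<close>, with
  one of the stage below.\<close>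

lemma interval_block:
  assumes "g \<in> Gr j"
  shows "g ` I i = I i \<or> g ` I i \<inter> I i = {}"
  using assms
proof (induction j arbitrary: g)
  case 0
  then have "g \<in> Gr i"
    using Gr_mono[of 0 i] by blast
  then show ?case
    using bij_image_supp[OF IncBijD(1)[OF S.H_D(1)] S.H_supp] by blast
next
  case (Suc j)
  show ?case
  proof (cases "Suc j \<le> i")
    case True
    then have "g \<in> Gr i"
      using Gr_mono Suc.prems by blast
    then show ?thesis
      using bij_image_supp[OF IncBijD(1)[OF S.H_D(1)] S.H_supp] by blast
  next
    case False
    then have ij: "I i \<subseteq> I j"
      by (intro I_mono) simp
    consider "g ` I j \<inter> I j = {}" | h where "h \<in> Gr j" "\<forall>x\<in>I j. g x = h x"
      using S.G'_block[of g j] Suc.prems by auto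
    then show ?thesis
    proof cases
      case 1
      then show ?thesis
        using ij by blast
    next
      case 2
      then have "g ` I i = h ` I i"
        using ij by (intro image_cong) auto
      then show ?thesis
        using Suc.IH[OF 2(1)] by simp
    qed
  qed
qed

section \<open>The union of the stages as a group\<close>

lemma carrier_L: "carrier L = (\<Union>i. Gr i)"
  by (simp add: limit_group_def)

lemma Gr_in_L: "g \<in> Gr i \<Longrightarrow> g \<in> carrier L"
  by (auto simp: carrier_L)

lemma L_D:
  assumes "g \<in> carrier L"
  shows "g \<in> IncBij" "supp g \<subseteq> X"
  using assms S.H_IncBij S.H_supp unfolding carrier_L X_def by blast+

lemma L_closed:
  "id \<in> carrier L" "g \<in> carrier L \<Longrightarrow> finv g \<in> carrier L"
  "g \<in> carrier L \<Longrightarrow> h \<in> carrier L \<Longrightarrow> g \<circ> h \<in> carrier L"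
proof -
  show "id \<in> carrier L" "g \<in> carrier L \<Longrightarrow> finv g \<in> carrier L"
    using S.H_closed(1,3) unfolding carrier_L by blast+
  assume gh: "g \<in> carrier L" "h \<in> carrier L"
  then obtain i j where "g \<in> Gr i" "h \<in> Gr j"
    unfolding carrier_L by blast
  then have "g \<in> Gr (max i j)" "h \<in> Gr (max i j)"
    using Gr_mono[of i "max i j"] Gr_mono[of j "max i j"] by auto
  then have "g \<circ> h \<in> Gr (max i j)"
    by (rule S.H_closed(2))
  then show "g \<circ> h \<in> carrier L"
    by (rule Gr_in_L)
qed

lemma subgroup_carrier_L: "subgroup (carrier L) SymR"
proof -
  have "\<forall>g\<in>carrier L. bij g"
    using L_D(1) IncBijD(1) by blast
  moreover have "\<forall>g\<in>carrier L. \<forall>h\<in>carrier L. g \<circ> h \<in> carrier L"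
    by (intro ballI L_closed(3))
  moreover have "\<forall>g\<in>carrier L. finv g \<in> carrier L"
    by (intro ballI L_closed(2))
  ultimately show ?thesis
    using L_closed(1) unfolding subgroup_SymR_iff by (intro conjI)
qed

lemma L_eq: "SymR\<lparr>carrier := carrier L\<rparr> = L"
  by (simp add: limit_group_def)

sublocale L: group L
  using SymR.subgroup_imp_group[OF subgroup_carrier_L] unfolding L_eq .

lemma mult_L: "f \<in> carrier L \<Longrightarrow> g \<in> carrier L \<Longrightarrow> f \<otimes>\<^bsub>L\<^esub> g = f \<circ> g"
  using mult_SymR[OF IncBijD(1)[OF L_D(1)] IncBijD(1)[OF L_D(1)], of f g]
  by (simp add: limit_group_def)

lemma inv_L: "f \<in> carrier L \<Longrightarrow> inv\<^bsub>L\<^esub> f = finv f"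
  using SymR.m_inv_consistent[OF subgroup_carrier_L, of f] inv_SymR[OF IncBijD(1)[OF L_D(1)], of f] L_eq
  by simp

lemma conjugate_L:
  assumes "f \<in> carrier L" "g \<in> carrier L"
  shows "conjugate L f g = f \<circ> g \<circ> finv f"
proof -
  have "finv f \<in> carrier L" "f \<circ> g \<in> carrier L"
    using assms L_closed by blast+
  then show ?thesis
    using assms by (simp add: conjugate_def inv_L mult_L)
qed

lemma nat_pow_L: "f \<in> carrier L \<Longrightarrow> f [^]\<^bsub>L\<^esub> (n :: nat) = f [^]\<^bsub>SymR\<^esub> int n"
  using SymR.nat_pow_consistent[of f n "carrier L"] L_eq by (simp add: int_pow_int)

lemma t_in_L: "t (Suc i) \<in> carrier L"
proof -
  have "t (Suc i) \<in> Gr (Suc i)"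
    using S.t_in_G'[of i] by simp
  then show ?thesis
    by (rule Gr_in_L)
qed

section \<open>Realisation on the union of the intervals, and dissipation\<close>

abbreviation restr :: "(real \<Rightarrow> real) \<Rightarrow> real \<Rightarrow> real"
  where "restr g \<equiv> restrict g X"

lemma restr_Bij:
  assumes "g \<in> carrier L"
  shows "restr g \<in> Bij X"
proof -
  have "g ` X = X"
    by (rule bij_image_supp[OF IncBijD(1) L_D(2)]) (use L_D(1) assms in auto)
  then have "bij_betw g X X"
    using IncBijD(1)[OF L_D(1)[OF assms]] by (auto simp: bij_betw_def bij_def intro: inj_on_subset)
  then show ?thesis
    by (simp add: Bij_def)
qed

lemma L_maps_X:
  assumes "g \<in> carrier L" "x \<in> X"
  shows "g x \<in> X"
  using bij_maps_into[OF IncBijD(1)[OF L_D(1)] L_D(2)] assms by blast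

lemma restr_hom: "restr \<in> hom L (BijGroup X)"
proof (rule homI)
  show "restr g \<in> carrier (BijGroup X)" if "g \<in> carrier L" for g
    using restr_Bij[OF that] by (simp add: BijGroup_def)
  show "restr (f \<otimes>\<^bsub>L\<^esub> g) = restr f \<otimes>\<^bsub>BijGroup X\<^esub> restr g"
    if "f \<in> carrier L" "g \<in> carrier L" for f g
    using that L_maps_X[OF that(2)] restr_Bij[OF that(1)] restr_Bij[OF that(2)]
    by (auto simp: BijGroup_def mult_L compose_def fun_eq_iff)
qed

sublocale R: group_hom L "BijGroup X" restr
  by (intro group_hom.intro group_hom_axioms.intro L.is_group group_BijGroup restr_hom)

text \<open>Restriction loses nothing: outside \<open>X\<close> every element is the
  identity.\<close>

lemma restr_inj: "inj_on restr (carrier L)"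
proof (rule inj_onI, rule ext)
  fix f g x
  assume fg: "f \<in> carrier L" "g \<in> carrier L" "restr f = restr g"
  show "f x = g x"
  proof (cases "x \<in> X")
    case True
    then show ?thesis
      using fun_cong[OF fg(3), of x] by simp
  next
    case False
    then show ?thesis
      using supp_outside[OF L_D(2)[OF fg(1)] False] supp_outside[OF L_D(2)[OF fg(2)] False] by metis
  qed
qed

lemma conjugate_restr:
  assumes "f \<in> carrier L" "g \<in> carrier L"
  shows "conjugate (BijGroup X) (restr f) (restr g) = restr (f \<circ> g \<circ> finv f)"
proof -
  have "conjugate (BijGroup X) (restr f) (restr g) = restr (conjugate L f g)"
    using assms by (simp add: conjugate_def)
  then show ?thesis
    using assms by (simp add: conjugate_L)
qed

text \<open>An element supported on \<open>I i\<close> comes from some \<open>h\<close> in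
  \<open>Gr i\<close> by \<open>supported_in_stage\<close>; only then is \<open>spread\<close>
  applicable, and its result lies in \<open>Gr (Suc i)\<close>.\<close>

lemma dissipator_restr: "dissipator X (restr ` carrier L) (I i) (restr (t (Suc i)))"
  unfolding dissipator_def
proof (intro conjI ballI allI impI)
  have IX: "I i \<subseteq> X"
    by (auto simp: X_def)
  have pow: "restr (t (Suc i)) [^]\<^bsub>BijGroup X\<^esub> p = restr (S.P i (int p))" for p :: nat
    using R.hom_nat_pow[OF t_in_L, of i p] nat_pow_L[OF t_in_L, of i p] by simp
  then have image: "(restr (t (Suc i)) [^]\<^bsub>BijGroup X\<^esub> p) ` I i = S.P i (int p) ` I i" for p :: nat
    using IX by (force intro!: image_cong)
  have P_L: "S.P i (int p) \<in> carrier L" for p :: nat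
    using L.nat_pow_closed[OF t_in_L, of i p] by (simp add: nat_pow_L t_in_L)
  show "restr (t (Suc i)) \<in> restr ` carrier L"
    using t_in_L by blast
  show "(restr (t (Suc i)) [^]\<^bsub>BijGroup X\<^esub> p) ` I i \<inter> I i = {}" if "1 \<le> p" for p :: nat
    unfolding image using S.P_escapes[of _ i p] that by auto
  fix g
  assume "g \<in> restr ` carrier L" and supp: "supp_on X g \<subseteq> I i"
  then obtain h where h: "h \<in> carrier L" "g = restr h"
    by blast
  have "supp h \<subseteq> I i"
    using supp L_D(2)[OF h(1)] by (force simp: h(2) supp_on_def)
  then have hG: "h \<in> Gr i"
    using h(1) supported_in_stage by (auto simp: carrier_L)
  let ?f = "S.spread i h"
  have "?f \<in> Gr (Suc i)"
    using S.spread_Om[OF hG] S.Om_subset_G'[of i] by auto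
  then have fL: "?f \<in> carrier L"
    by (rule Gr_in_L)
  show "\<exists>f\<in>restr ` carrier L.
       (\<forall>p::nat. 1 \<le> p \<longrightarrow> (\<forall>x\<in>(restr (t (Suc i)) [^]\<^bsub>BijGroup X\<^esub> p) ` I i.
          f x = conjugate (BijGroup X) (restr (t (Suc i)) [^]\<^bsub>BijGroup X\<^esub> p) g x)) \<and>
       (\<forall>x\<in>X - (\<Union>p\<in>{1::nat..}. (restr (t (Suc i)) [^]\<^bsub>BijGroup X\<^esub> p) ` I i). f x = x)"
  proof (intro bexI[of _ "restr ?f"] conjI allI impI ballI)
    show "restr ?f \<in> restr ` carrier L"
      using fL by blast
  next
    fix p :: nat and x
    assume p: "1 \<le> p" and "x \<in> (restr (t (Suc i)) [^]\<^bsub>BijGroup X\<^esub> p) ` I i"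
    then obtain y where y: "y \<in> I i" "x = S.P i (int p) y"
      unfolding image by blast
    have x: "x \<in> X"
      using L_maps_X[OF P_L, of y p] y IX by auto
    have "?f x = S.P i (int p) (h y)"
      using S.spread_in[of "int p" y i h] p y by simp
    moreover have "finv (S.P i (int p)) x = y"
      by (simp add: y(2) S.P(5))
    ultimately show "restr ?f x = conjugate (BijGroup X) (restr (t (Suc i)) [^]\<^bsub>BijGroup X\<^esub> p) g x"
      unfolding pow h(2) conjugate_restr[OF P_L h(1)] using x by simp
  next
    fix x
    assume x: "x \<in> X - (\<Union>p\<in>{1::nat..}. (restr (t (Suc i)) [^]\<^bsub>BijGroup X\<^esub> p) ` I i)"
    have "?f x = x"
    proof (rule S.spread_out, rule notI)
      fix p y
      assume "1 \<le> p" "y \<in> I i" "x = S.P i p y"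
      then have "x \<in> S.P i (int (nat p)) ` I i" "nat p \<in> {1..}"
        by auto
      then show False
        using x unfolding image by blast
    qed
    then show "restr ?f x = x"
      using x by simp
  qed
qed

lemma dissipated_L: "dissipated TYPE(real) TYPE(nat) L"
proof -
  let ?D = "restr ` carrier L"
  have "directed_union X UNIV I"
    unfolding directed_union_def X_def by (metis I_mono UNIV_I UNIV_not_empty nat_le_linear order_refl)
  moreover have "subgroup ?D (BijGroup X)"
    by (rule R.img_is_subgroup)
  moreover have "\<exists>i. supp_on X g \<subseteq> I i" if g: "g \<in> ?D" for g
  proof -
    obtain h i where h: "h \<in> Gr i" "g = restr h"
      using g by (auto simp: carrier_L)
    then have "supp_on X g \<subseteq> I i"
      using S.H_supp[OF h(1)] by (auto simp: supp_on_def)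
    then show ?thesis
      by blast
  qed
  ultimately have "dissipated_on X UNIV I ?D"
    unfolding dissipated_on_def using dissipator_restr by blast
  moreover have "L \<cong> (BijGroup X)\<lparr>carrier := ?D\<rparr>"
  proof -
    have "restr \<in> iso L ((BijGroup X)\<lparr>carrier := ?D\<rparr>)"
      using restr_hom restr_inj by (intro isoI) (auto simp: hom_def bij_betw_def)
    then show ?thesis
      by (auto simp: is_iso_def)
  qed
  ultimately show ?thesis
    unfolding dissipated_def by blast
qed

text \<open>On \<open>I i\<close> the two sides of the commutation hypothesis are \<open>T\<^sup>2 r\<^sup>-\<^sup>1\<close> and \<open>T\<^sup>2\<close>,
  where \<open>T = t (Suc i)\<close>.\<close>

lemma supported_commuting_trivial:
  assumes r: "bij r" "supp r \<subseteq> I i"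
    and comm: "t (Suc i) \<circ> (r \<circ> t (Suc i) \<circ> finv r) = (r \<circ> t (Suc i) \<circ> finv r) \<circ> t (Suc i)"
    and x: "x \<in> I i"
  shows "r x = x"
proof -
  let ?T = "t (Suc i)"
  \<comment> \<open>Points outside \<open>I i\<close> are fixed by \<open>r\<close> and its inverse,
    so these two facts cancel all occurrences of \<open>r\<close> in the commutation relation at
    \<open>x\<close> except one.\<close>
  have out: "?T y \<notin> I i" "?T (?T y) \<notin> I i" if "y \<in> I i" for y
    using S.P_escapes[OF that, of 1] S.P_escapes[OF that, of 2] S.P_add[of i 1 1 y] S.P_1[of i]
    by simp_all
  have inv: "supp (finv r) \<subseteq> I i" "bij (finv r)"
    using r by (simp_all add: supp_inv bij_imp_bij_inv)
  have y: "finv r x \<in> I i"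
    by (rule bij_maps_into[OF inv(2,1) x])
  have "?T (?T (finv r x)) = ?T (r (?T (finv r x)))"
    by (simp only: supp_outside[OF r(2) out(1)[OF y]])
  also have "\<dots> = r (?T (finv r (?T x)))"
    using fun_cong[OF comm, of x] by simp
  also have "\<dots> = ?T (?T x)"
    by (simp only: supp_outside[OF inv(1) out(1)[OF x]] supp_outside[OF r(2) out(2)[OF x]])
  finally have "finv r x = x"
    by (simp add: IncBijD(4)[OF S.t_IncBij])
  then show ?thesis
    using bij_inv_eq_iff[OF r(1), of x x] by simp
qed

lemma not_commuting_Z_conjugates_L: "\<not> commuting_Z_conjugates L"
proof
  assume "commuting_Z_conjugates L"
  from L.commuting_Z_conjugates_imp[OF this] obtain s where s: "s \<in> carrier L" and
    comm: "\<forall>S. finite S \<and> S \<subseteq> carrier L \<longrightarrow> (\<exists>g\<in>carrier L. \<forall>u\<in>S. \<forall>v\<in>S.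
      u \<otimes>\<^bsub>L\<^esub> conjugate L (conjugate L g s) v = conjugate L (conjugate L g s) v \<otimes>\<^bsub>L\<^esub> u)"
    by (elim bexE)
  obtain i where i: "s \<in> Gr i"
    using s by (auto simp: carrier_L)
  obtain a b where ab: "a \<in> Thompson_F" "b \<in> Thompson_F" "a \<circ> b \<noteq> b \<circ> a"
    by (rule Thompson_F_nonabelian)
  have F: "Thompson_F \<subseteq> Gr i"
    using Gr_mono[of 0 i] by simp
  then have abi: "a \<in> Gr i" "b \<in> Gr i"
    using ab by auto
  have S: "{a, b, t (Suc i)} \<subseteq> carrier L"
    using abi[THEN Gr_in_L] t_in_L by simp
  \<comment> \<open>The test set depends on \<open>s\<close>: \<open>t (Suc i)\<close> displaces
    \<open>I i\<close>, which contains the support of \<open>s\<close>.\<close>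
  have "finite {a, b, t (Suc i)} \<and> {a, b, t (Suc i)} \<subseteq> carrier L"
    using S by simp
  from comm[rule_format, OF this]
  obtain g where g: "g \<in> carrier L" and gS: "\<forall>u\<in>{a, b, t (Suc i)}. \<forall>v\<in>{a, b, t (Suc i)}.
      u \<otimes>\<^bsub>L\<^esub> conjugate L (conjugate L g s) v = conjugate L (conjugate L g s) v \<otimes>\<^bsub>L\<^esub> u"
    by (elim bexE)
  define r where "r = conjugate L g s"
  have r: "r \<in> carrier L" "r = g \<circ> s \<circ> finv g"
    using g s by (simp_all add: r_def conjugate_L L_closed)
  have r_bij: "bij r"
    by (rule IncBijD(1)[OF L_D(1)[OF r(1)]])
  note G = IncBijD[OF L_D(1)[OF g]]
  have r_comm: "u \<circ> (r \<circ> v \<circ> finv r) = (r \<circ> v \<circ> finv r) \<circ> u"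
    if "u \<in> {a, b, t (Suc i)}" "v \<in> {a, b, t (Suc i)}" for u v
  proof -
    have uv: "u \<in> carrier L" "v \<in> carrier L"
      using that S by auto
    have "r \<circ> v \<circ> finv r \<in> carrier L"
      using L.conjugate_closed[OF r(1) uv(2)] conjugate_L[OF r(1) uv(2)] by simp
    then show ?thesis
      using gS[rule_format, OF that] uv mult_L unfolding r_def[symmetric] conjugate_L[OF r(1) uv(2)] by simp
  qed
  \<comment> \<open>The support of \<open>r\<close> is the image under \<open>g\<close> of that of
    \<open>s\<close>, so it lies in the image of \<open>I i\<close>; where \<open>g\<close> sends
    \<open>I i\<close> decides the argument.\<close>
  obtain j where "g \<in> Gr j"
    using g by (auto simp: carrier_L)
  then consider "g ` I i = I i" | "g ` I i \<inter> I i = {}"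
    using interval_block by blast
  then have r_fix: "r x = x" if "x \<in> I i" for x
  proof cases
    case 1
    have "supp r \<subseteq> I i"
    proof
      fix x
      assume "x \<in> supp r"
      then have "s (finv g x) \<noteq> finv g x"
        by (auto simp: r supp_on_def G)
      then have "finv g x \<in> I i"
        using S.H_D(3)[OF i] by blast
      then have "g (finv g x) \<in> g ` I i"
        by (rule imageI)
      then show "x \<in> I i"
        by (simp only: G 1)
    qed
    \<comment> \<open>The relation used here is the one with \<open>u\<close> and \<open>v\<close>
      both equal to \<open>t (Suc i)\<close>.\<close>
    then show ?thesis
      using that by (intro supported_commuting_trivial r_bij r_comm) auto
  next
    case 2
    have "finv g x \<notin> I i"
    proof
      assume "finv g x \<in> I i"
      then have "g (finv g x) \<in> g ` I i"
        by (rule imageI)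
      then show False
        using 2 that by (auto simp: G)
    qed
    then show ?thesis
      using S.H_D(3)[OF i] by (simp add: r G)
  qed
  have r_inv: "finv r x = x" if "x \<in> I i" for x
    using r_fix[OF that] bij_inv_eq_iff[OF r_bij, of x x] by simp
  \<comment> \<open>\<open>r\<close> is the identity on \<open>I i\<close>, where \<open>b\<close>
    lives, and therefore keeps the complement, where \<open>b\<close> is the identity.\<close>
  have "(r \<circ> b \<circ> finv r) x = b x" for x
  proof (cases "x \<in> I i")
    case True
    then show ?thesis
      using r_inv r_fix[OF S.H_D(2)[OF abi(2) True]] by simp
  next
    case False
    have "r (finv r x) = x"
      using r_bij by (simp add: bij_is_surj surj_f_inv_f)
    moreover from this have "finv r x \<notin> I i"
      using r_fix[of "finv r x"] False by auto
    ultimately show ?thesis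
      using S.H_D(3)[OF abi(2)] False by simp
  qed
  then have "r \<circ> b \<circ> finv r = b"
    by blast
  then show False
    using r_comm[of a b] ab(3) by simp
qed

end

theorem proposition3p13:
  fixes t :: "nat \<Rightarrow> real \<Rightarrow> real"
  assumes "admissible_choice t"
  shows "dissipated TYPE(real) TYPE(nat) (limit_group t) \<and>
         \<not> commuting_Z_conjugates (limit_group t)"
proof -
  interpret tower t
    by (rule tower.intro[OF assms])
  show ?thesis
    using dissipated_L not_commuting_Z_conjugates_L by blast
qed

end
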